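(* Let $A$ be an $n\times n$ Hermitian matrix of rank $r\le n$ with polar factor $P$ and eigenvalues ordered so that $\lambda_1\ge\dots\ge\lambda_r$ are its nonzero eigenvalues and $\lambda_{r+1}=\dots=\lambda_n=0$. Let $E$ be an $n\times n$ Hermitian matrix. Let $A_1$ be an $n\times n$ matrix with left polar factorisation $A_1=P_1S_1$, and let $A_2$ be an $n\times n$ matrix with right polar factorisation $A_2=S_2P_2$. If $P=P_1P_2=P_2P_1$ and $k=\|A_1^{+}EA_2^{+}\|\le 1$, then for every $i\in\{1,\dots,r\}$, $$\lambda_{n-r+i}(A+E)\le \lambda_i+k|\lambda_i|\qquad\text{and}\qquad \lambda_i(A+E)\ge \lambda_i-k|\lambda_i|,$$ where the eigenvalues of $A+E$ are in decreasing order $\lambda_1(A+E)\ge\dots\ge\lambda_n(A+E)$.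
   Context: All matrices are complex. $\|\cdot\|$ is the matrix 2-norm (largest singular value) and $X^{+}$ is the Moore-Penrose pseudo-inverse. The polar factor of a Hermitian matrix $A$ is the positive semi-definite matrix $P=(A^{*}A)^{1/2}$. In the left polar factorisation $A_1=P_1S_1$, $P_1=(A_1A_1^{*})^{1/2}$ is positive semi-definite and $S_1$ is unitary; in the right polar factorisation $A_2=S_2P_2$, $P_2=(A_2^{*}A_2)^{1/2}$ is positive semi-definite and $S_2$ is unitary. Eigenvalues are counted with multiplicity. *)

theory Defs
  imports
    "Jordan_Normal_Form.Char_Poly"
    "Jordan_Normal_Form.Schur_Decomposition"
    "Jordan_Normal_Form.DL_Rank"
begin

definition hermitian_mat :: "complex mat \<Rightarrow> bool" where
  "hermitian_mat A \<longleftrightarrow> square_mat A \<and> mat_adjoint A = A"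

definition unitary_mat :: "complex mat \<Rightarrow> bool" where
  "unitary_mat U \<longleftrightarrow> square_mat U \<and>
     mat_adjoint U * U = 1\<^sub>m (dim_row U) \<and> U * mat_adjoint U = 1\<^sub>m (dim_row U)"

text \<open>In the order on complex numbers, \<open>0 \<le> z\<close> means that \<open>z\<close> is real and nonnegative.\<close>

definition psd_mat :: "complex mat \<Rightarrow> bool" where
  "psd_mat A \<longleftrightarrow> hermitian_mat A \<and>
     (\<forall>v \<in> carrier_vec (dim_row A). 0 \<le> (A *\<^sub>v v) \<bullet>c v)"

text \<open>Meaningful for positive semi-definite \<open>B\<close>, where the square root exists and is unique.\<close>

definition psd_sqrt :: "complex mat \<Rightarrow> complex mat" where
  "psd_sqrt B = (THE P. P \<in> carrier_mat (dim_row B) (dim_row B) \<and> psd_mat P \<and> P * P = B)"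

definition polar_factor :: "complex mat \<Rightarrow> complex mat" where
  "polar_factor A = psd_sqrt (mat_adjoint A * A)"

definition left_polar_factorisation :: "complex mat \<Rightarrow> complex mat \<Rightarrow> complex mat \<Rightarrow> bool" where
  "left_polar_factorisation A P S \<longleftrightarrow>
     S \<in> carrier_mat (dim_row A) (dim_col A) \<and> unitary_mat S \<and>
     P = psd_sqrt (A * mat_adjoint A) \<and> A = P * S"

definition right_polar_factorisation :: "complex mat \<Rightarrow> complex mat \<Rightarrow> complex mat \<Rightarrow> bool" where
  "right_polar_factorisation A S P \<longleftrightarrow>
     S \<in> carrier_mat (dim_row A) (dim_col A) \<and> unitary_mat S \<and>
     P = psd_sqrt (mat_adjoint A * A) \<and> A = S * P"

text \<open>The four Penrose conditions; every complex matrix has exactly one such inverse.\<close>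

definition is_pseudo_inverse :: "complex mat \<Rightarrow> complex mat \<Rightarrow> bool" where
  "is_pseudo_inverse A X \<longleftrightarrow>
     X \<in> carrier_mat (dim_col A) (dim_row A) \<and>
     A * X * A = A \<and> X * A * X = X \<and>
     mat_adjoint (A * X) = A * X \<and> mat_adjoint (X * A) = X * A"

definition pseudo_inverse :: "complex mat \<Rightarrow> complex mat" where
  "pseudo_inverse A = (THE X. is_pseudo_inverse A X)"

text \<open>The eigenvalues of \<open>A\<^sup>*A\<close> are real and nonnegative, so taking real parts loses nothing.\<close>

definition singular_values :: "complex mat \<Rightarrow> real set" where
  "singular_values A = {sqrt (Re c) |c. eigenvalue (mat_adjoint A * A) c}"

text \<open>The largest singular value; unspecified for matrices without columns.\<close>

definition mat_norm2 :: "complex mat \<Rightarrow> real" where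
  "mat_norm2 A = Max (singular_values A)"

text \<open>\<open>l 1, \<dots>, l n\<close> lists the eigenvalues of the \<open>n \<times> n\<close> matrix \<open>A\<close> (all of them real), each as
  often as its multiplicity as a root of the characteristic polynomial, in no particular order.
  Values of \<open>l\<close> outside \<open>{1..n}\<close> are irrelevant.\<close>

definition eigenvalue_listing :: "complex mat \<Rightarrow> (nat \<Rightarrow> real) \<Rightarrow> bool" where
  "eigenvalue_listing A l \<longleftrightarrow>
     char_poly A = (\<Prod>i\<in>{1..dim_row A}. [:- complex_of_real (l i), 1:])"

end

theory Submission
  imports Defs
begin

text \<open>Write \<open>K\<close> for the matrix \<open>P\<^sub>1\<^sup>+ E P\<^sub>2\<^sup>+\<close>; the unitary factors of \<open>A\<^sub>1\<close> and \<open>A\<^sub>2\<close> do not affect norms, so its norm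
  is \<open>k\<close>. The theorem rests on the inequality \<open>\<bar>x\<^sup>* E x\<bar> \<le> k x\<^sup>* P x\<close> for \<open>x\<close> in the range of \<open>P\<close>, which is
  also the range of \<open>A\<close>.

  For the inequality, \<open>P\<^sub>1\<close> and \<open>P\<^sub>2\<close> commute, so they are diagonal in a common unitary basis, with
  entries \<open>a i\<close> and \<open>b i\<close>, and \<open>P\<close> has the entries \<open>a i * b i\<close>. On the range of \<open>P\<close>, scaling \<open>E\<close> from both sides by the
  inverse square root of \<open>P\<close> gives a Hermitian matrix \<open>H\<close> which is similar to the compression of \<open>K\<close>, by way of the
  diagonal matrix with entries \<open>sqrt (a i / b i)\<close>. The eigenvalues of \<open>H\<close> are thus at most
  the norm of \<open>K\<close> in modulus, and for a Hermitian matrix this bounds the quadratic form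
  (\<open>relative_form_bound\<close>, \<open>polar_factorisations_form_bound\<close>).

  The polar factor \<open>P\<close> is the absolute value of \<open>A\<close>. On the range of \<open>A\<close>, the form of \<open>A + E\<close> therefore lies
  between those of \<open>A - k P\<close> and \<open>A + k P\<close>, which are diagonal in an eigenbasis of \<open>A\<close> with entries
  \<open>\<lambda>\<^sub>j - k \<bar>\<lambda>\<^sub>j\<bar>\<close> and \<open>\<lambda>\<^sub>j + k \<bar>\<lambda>\<^sub>j\<bar>\<close>; as \<open>k \<le> 1\<close>, these are still in decreasing order. The
  span of the eigenvectors of \<open>A\<close> for \<open>\<lambda>\<^sub>i, \<dots>, \<lambda>\<^sub>r\<close> has dimension \<open>r - i + 1\<close> and hence meets the span of the
  eigenvectors of \<open>A + E\<close> for its \<open>n - r + i\<close> largest eigenvalues. A common vector gives the upper bound. The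
  lower bound comes from \<open>\<lambda>\<^sub>1, \<dots>, \<lambda>\<^sub>i\<close> and the \<open>n - i + 1\<close> smallest eigenvalues of \<open>A + E\<close>
  (\<open>eigenvalue_le_of_form_le\<close>, \<open>eigenvalue_ge_of_form_ge\<close>).

  All eigenbases come from one spectral theorem for normal matrices
  (\<open>normal_unitarily_diagonalisable\<close>). It also yields existence and uniqueness of positive
  semi-definite square roots and explicit pseudo-inverses.\<close>

section \<open>Adjoints and the inner product\<close>

lemma mat_adjoint_carrier [simp]:
  "A \<in> carrier_mat m n \<Longrightarrow> mat_adjoint (A :: complex mat) \<in> carrier_mat n m"
  by (auto simp: mat_adjoint_def mat_of_rows_def)

lemma dim_mat_adjoint [simp]:
  "dim_row (mat_adjoint (A :: complex mat)) = dim_col A"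
  "dim_col (mat_adjoint (A :: complex mat)) = dim_row A"
  by (auto simp: mat_adjoint_def mat_of_rows_def)

lemma index_mat_adjoint [simp]:
  "i < dim_col A \<Longrightarrow> j < dim_row A \<Longrightarrow> mat_adjoint (A :: complex mat) $$ (i, j) = cnj (A $$ (j, i))"
  by (auto simp: mat_adjoint_def mat_of_rows_def)

lemma mat_adjoint_adjoint [simp]: "mat_adjoint (mat_adjoint (A :: complex mat)) = A"
  by (rule eq_matI) auto

lemma index_mult_mat_sum:
  assumes "A \<in> carrier_mat m n" "B \<in> carrier_mat n p" "i < m" "j < p"
  shows "(A * B) $$ (i, j) = (\<Sum>k<n. A $$ (i, k) * B $$ (k, j))"
  using assms by (simp add: scalar_prod_def lessThan_atLeast0)

lemma index_mult_mat_vec_sum: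
  assumes "A \<in> carrier_mat m n" "x \<in> carrier_vec n" "i < m"
  shows "(A *\<^sub>v x) $ i = (\<Sum>k<n. A $$ (i, k) * x $ k)"
  using assms by (simp add: scalar_prod_def lessThan_atLeast0)

lemma cscalar_prod_sum:
  assumes "y \<in> carrier_vec n"
  shows "x \<bullet>c (y :: complex vec) = (\<Sum>k<n. x $ k * cnj (y $ k))"
  using assms by (simp add: scalar_prod_def lessThan_atLeast0)

lemma mat_adjoint_mult:
  assumes "A \<in> carrier_mat m n" "B \<in> carrier_mat n p"
  shows "mat_adjoint (A * B) = mat_adjoint B * mat_adjoint (A :: complex mat)"
proof (rule eq_matI)
  fix i j assume "i < dim_row (mat_adjoint B * mat_adjoint A)" "j < dim_col (mat_adjoint B * mat_adjoint A)"
  with assms have ij: "i < p" "j < m" by auto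
  show "mat_adjoint (A * B) $$ (i, j) = (mat_adjoint B * mat_adjoint A) $$ (i, j)"
    using assms ij
    by (simp add: index_mult_mat_sum[of _ p n _ m] index_mult_mat_sum[of _ m n _ p]
        mult.commute del: index_mult_mat(1))
qed (use assms in auto)

lemma adjoint_cscalar_prod:
  assumes "A \<in> carrier_mat m n" "x \<in> carrier_vec n" "y \<in> carrier_vec m"
  shows "(A *\<^sub>v x) \<bullet>c y = x \<bullet>c (mat_adjoint A *\<^sub>v (y :: complex vec))"
proof -
  have "(A *\<^sub>v x) \<bullet>c y = (\<Sum>i<m. \<Sum>j<n. A $$ (i, j) * x $ j * cnj (y $ i))"
    using assms
    by (simp add: cscalar_prod_sum[of _ m] index_mult_mat_vec_sum[of _ m n] sum_distrib_right
        del: index_mult_mat_vec)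
  also have "\<dots> = (\<Sum>j<n. \<Sum>i<m. A $$ (i, j) * x $ j * cnj (y $ i))" by (rule sum.swap)
  also have "\<dots> = x \<bullet>c (mat_adjoint A *\<^sub>v y)"
    using assms
    by (simp add: cscalar_prod_sum[of _ n] index_mult_mat_vec_sum[of _ n m] sum_distrib_left
        mult_mat_vec_carrier[of _ n m] algebra_simps del: index_mult_mat_vec)
  finally show ?thesis .
qed

text \<open>The squared norm is kept real, so that it can be compared with real bounds.\<close>

definition norm_sq :: "complex vec \<Rightarrow> real" where
  "norm_sq x = (\<Sum>k<dim_vec x. (cmod (x $ k))\<^sup>2)"

lemma cscalar_prod_self: "x \<bullet>c x = complex_of_real (norm_sq x)"
  by (simp add: norm_sq_def scalar_prod_def lessThan_atLeast0 complex_norm_square del: of_real_power)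

lemma norm_sq_nonneg [simp]: "0 \<le> norm_sq x"
  by (simp add: norm_sq_def sum_nonneg)

lemma norm_sq_pos:
  assumes "x \<in> carrier_vec n" "x \<noteq> 0\<^sub>v n"
  shows "0 < norm_sq x"
proof -
  have "norm_sq x \<noteq> 0"
    using assms cscalar_prod_self[of x] conjugate_square_eq_0_vec[of x n] by auto
  then show ?thesis using norm_sq_nonneg[of x] by linarith
qed

lemma norm_sq_smult: "norm_sq (c \<cdot>\<^sub>v x) = (cmod c)\<^sup>2 * norm_sq x"
  by (simp add: norm_sq_def norm_mult power_mult_distrib sum_distrib_left)

lemma norm_sq_adjoint:
  assumes "A \<in> carrier_mat m n" "x \<in> carrier_vec n"
  shows "complex_of_real (norm_sq (A *\<^sub>v x)) = ((mat_adjoint A * A) *\<^sub>v x) \<bullet>c x"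
proof -
  have "((mat_adjoint A * A) *\<^sub>v x) \<bullet>c x = (mat_adjoint A *\<^sub>v (A *\<^sub>v x)) \<bullet>c x"
    using assms by (simp add: assoc_mult_mat_vec[of _ n m _ n])
  also have "\<dots> = (A *\<^sub>v x) \<bullet>c (mat_adjoint (mat_adjoint A) *\<^sub>v x)"
    using assms by (intro adjoint_cscalar_prod[of _ n m] mult_mat_vec_carrier[of _ m n]) auto
  also have "\<dots> = complex_of_real (norm_sq (A *\<^sub>v x))"
    by (simp add: cscalar_prod_self)
  finally show ?thesis by simp
qed

lemma unitary_matD:
  assumes "unitary_mat U" "U \<in> carrier_mat n n"
  shows "mat_adjoint U * U = 1\<^sub>m n" "U * mat_adjoint U = 1\<^sub>m n"
  using assms by (auto simp: unitary_mat_def)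

lemma unitary_matI:
  assumes "U \<in> carrier_mat n n" "mat_adjoint U * U = 1\<^sub>m n"
  shows "unitary_mat U"
  using assms mat_mult_left_right_inverse[of "mat_adjoint U" n U]
  by (auto simp: unitary_mat_def)

lemma unitary_mat_adjoint:
  assumes "unitary_mat U" shows "unitary_mat (mat_adjoint U)"
  using assms by (auto simp: unitary_mat_def)

lemma unitary_mat_mult:
  assumes "U \<in> carrier_mat n n" "V \<in> carrier_mat n n" "unitary_mat U" "unitary_mat V"
  shows "unitary_mat (U * V)"
proof (rule unitary_matI)
  have "mat_adjoint (U * V) * (U * V) = mat_adjoint V * (mat_adjoint U * U) * V"
    using assms by (simp add: mat_adjoint_mult[of _ n n _ n] assoc_mult_mat[of _ n n _ n _ n]
      mult_carrier_mat[of _ n n _ n])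
  then show "mat_adjoint (U * V) * (U * V) = 1\<^sub>m n"
    using assms by (simp add: unitary_matD[of _ n])
qed (use assms in auto)

lemma norm_sq_unitary:
  assumes "unitary_mat U" "U \<in> carrier_mat n n" "x \<in> carrier_vec n"
  shows "norm_sq (U *\<^sub>v x) = norm_sq x"
  using norm_sq_adjoint[OF assms(2,3)] unitary_matD[OF assms(1,2)] assms(3)
  by (simp add: cscalar_prod_self)

section \<open>Unitary diagonalisation of normal matrices\<close>

text \<open>Extend \<open>v\<close> to a basis, orthogonalise it, and normalise the resulting vectors; Gram-Schmidt
  leaves the first vector unchanged, and the normalisation merely scales it.\<close>

lemma unitary_with_first_column:
  assumes v: "v \<in> carrier_vec n" "v \<noteq> 0\<^sub>v n"
  obtains W c where "W \<in> carrier_mat n n" "unitary_mat W" "col W 0 = c \<cdot>\<^sub>v (v :: complex vec)"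
proof -
  interpret cof_vec_space n "TYPE(complex)" .
  define b where "b = basis_completion v"
  from basis_completion[OF v, folded b_def]
  have b: "distinct b" "\<not> lin_dep (set b)" "set b \<subseteq> carrier_vec n" "hd b = v" "length b = n"
    by auto
  have n: "n \<noteq> 0" using v by auto
  with b obtain vs where bv: "b = v # vs" by (cases b) auto
  define ws where "ws = gram_schmidt n b"
  from gram_schmidt_result[OF b(3,1,2) refl, folded ws_def] b
  have ws: "set ws \<subseteq> carrier_vec n" "corthogonal ws" "length ws = n" by auto
  have "hd ws = v" using gram_schmidt_hd[OF v(1), of vs, folded bv] by (simp add: ws_def)
  with ws n have ws0: "ws ! 0 = v" by (cases ws) auto
  have wsi: "ws ! i \<in> carrier_vec n" if "i < n" for i using ws that by auto
  define nrm where "nrm i = complex_of_real (1 / sqrt (norm_sq (ws ! i)))" for i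
  define W where "W = mat_of_cols n (map (\<lambda>i. nrm i \<cdot>\<^sub>v (ws ! i)) [0..<n])"
  have W: "W \<in> carrier_mat n n" unfolding W_def by auto
  have colW: "col W i = nrm i \<cdot>\<^sub>v (ws ! i)" if "i < n" for i
    unfolding W_def using that wsi[OF that] by (subst col_mat_of_cols) auto
  have "mat_adjoint W * W = 1\<^sub>m n"
  proof (rule eq_matI)
    fix i j assume "i < dim_row (1\<^sub>m n :: complex mat)" "j < dim_col (1\<^sub>m n :: complex mat)"
    then have ij: "i < n" "j < n" by auto
    have "(mat_adjoint W * W) $$ (i, j) = (\<Sum>k<n. col W j $ k * cnj (col W i $ k))"
      using W ij by (simp add: index_mult_mat_sum[of _ n n _ n] mult.commute del: index_mult_mat(1))
    also have "\<dots> = nrm j * cnj (nrm i) * (\<Sum>k<n. ws ! j $ k * cnj (ws ! i $ k))"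
      unfolding colW[OF ij(1)] colW[OF ij(2)] sum_distrib_left
      using wsi[OF ij(1)] wsi[OF ij(2)] by (intro sum.cong) auto
    also have "(\<Sum>k<n. ws ! j $ k * cnj (ws ! i $ k)) = ws ! j \<bullet>c ws ! i"
      using cscalar_prod_sum[OF wsi[OF ij(1)]] by simp
    also have "nrm j * cnj (nrm i) * (ws ! j \<bullet>c ws ! i) = (if i = j then 1 else 0)"
    proof (cases "i = j")
      case True
      have "ws ! i \<bullet>c ws ! i \<noteq> 0" using corthogonalD[OF ws(2), of i i] ij ws by simp
      then have "norm_sq (ws ! i) \<noteq> 0" by (simp add: cscalar_prod_self)
      then have p: "norm_sq (ws ! i) > 0" using norm_sq_nonneg[of "ws ! i"] by linarith
      have "nrm i * cnj (nrm i) * (ws ! i \<bullet>c ws ! i)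
          = complex_of_real (1 / sqrt (norm_sq (ws ! i)) * (1 / sqrt (norm_sq (ws ! i))) * norm_sq (ws ! i))"
        unfolding nrm_def cscalar_prod_self complex_cnj_complex_of_real of_real_mult ..
      also have "1 / sqrt (norm_sq (ws ! i)) * (1 / sqrt (norm_sq (ws ! i))) * norm_sq (ws ! i) = 1"
        using p by (simp add: field_simps)
      finally show ?thesis using True by simp
    next
      case False
      then show ?thesis using corthogonalD[OF ws(2), of j i] ij ws by simp
    qed
    finally show "(mat_adjoint W * W) $$ (i, j) = (1\<^sub>m n :: complex mat) $$ (i, j)" using ij by simp
  qed (use W in auto)
  then have "unitary_mat W" by (rule unitary_matI[OF W])
  moreover have "col W 0 = nrm 0 \<cdot>\<^sub>v v" using colW[of 0] n ws0 by simp
  ultimately show thesis using that W by blast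
qed

text \<open>The normal matrix that has the columns of the unitary matrix \<open>U\<close> as eigenvectors with
  eigenvalues \<open>d 0\<close>, \<open>d 1\<close> and so on.\<close>

definition diag_conj :: "complex mat \<Rightarrow> (nat \<Rightarrow> complex) \<Rightarrow> complex mat" where
  "diag_conj U d = U * mat_diag (dim_row U) d * mat_adjoint U"

lemma conj_diag_conj:
  assumes "W \<in> carrier_mat n n" "K \<in> carrier_mat n n"
  shows "W * diag_conj K d * mat_adjoint W = diag_conj (W * K) d"
  using assms
  by (simp add: diag_conj_def mat_adjoint_mult[of _ n n _ n] assoc_mult_mat[of _ n n _ n _ n]
      mult_carrier_mat[of _ n n _ n])

lemma unitary_similarity_products:
  assumes A: "A \<in> carrier_mat n n" and W: "W \<in> carrier_mat n n" "unitary_mat W"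
    and B: "B = mat_adjoint W * A * W"
  shows "mat_adjoint B * B = mat_adjoint W * (mat_adjoint A * A) * W"
    and "B * mat_adjoint B = mat_adjoint W * (A * mat_adjoint A) * W"
    and "A = W * B * mat_adjoint W"
proof -
  note [simp] = mat_adjoint_mult[of _ n n _ n] assoc_mult_mat[of _ n n _ n _ n]
      mult_carrier_mat[of _ n n _ n]
  have cancel: "W * (mat_adjoint W * X) = X" if "X \<in> carrier_mat n n" for X
  proof -
    have "W * (mat_adjoint W * X) = (W * mat_adjoint W) * X" using W that by simp
    then show ?thesis using W that by (simp add: unitary_matD[of _ n] del: assoc_mult_mat)
  qed
  show "mat_adjoint B * B = mat_adjoint W * (mat_adjoint A * A) * W"
    "B * mat_adjoint B = mat_adjoint W * (A * mat_adjoint A) * W"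
    "A = W * B * mat_adjoint W"
    using assms by (simp_all add: cancel unitary_matD[of _ n])
qed

text \<open>Induction on the list of eigenvalues. A unitary change of basis turns the first column of \<open>A\<close>
  into a multiple of the first unit vector; as the matrix is normal, the first row is then of the same form, so
  one eigenvalue splits off as a block and the remaining block is normal again. Since the
  eigenvalues are split off in the order of the list, the order on the diagonal can be prescribed.\<close>

theorem normal_unitarily_diagonalisable:
  assumes "A \<in> carrier_mat n n" "mat_adjoint A * A = A * mat_adjoint A"
    and "char_poly A = (\<Prod>e \<leftarrow> es. [:- e, 1:])"
  shows "\<exists>U \<in> carrier_mat n n. unitary_mat U \<and> A = diag_conj U (\<lambda>i. es ! i)"
  using assms
proof (induct es arbitrary: n A)
  case Nil
  then have "n = 0" using degree_monic_char_poly[of A n] by auto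
  with Nil show ?case
    by (intro bexI[of _ "1\<^sub>m 0"]) (auto simp: unitary_mat_def diag_conj_def intro!: eq_matI)
next
  case (Cons e es n A)
  note A = Cons(2) and normal = Cons(3)
  have cp: "char_poly A = [:- e, 1:] * (\<Prod>e \<leftarrow> es. [:- e, 1:])" using Cons(4) by simp
  have "eigenvalue A e" unfolding eigenvalue_root_char_poly[OF A] cp by simp
  then obtain v where v: "v \<in> carrier_vec n" "v \<noteq> 0\<^sub>v n" "A *\<^sub>v v = e \<cdot>\<^sub>v v"
    using A by (auto simp: eigenvalue_def eigenvector_def)
  obtain W c where W: "W \<in> carrier_mat n n" "unitary_mat W" and c: "col W 0 = c \<cdot>\<^sub>v v"
    using unitary_with_first_column[OF v(1,2)] by blast
  have "n \<noteq> 0" using v by auto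
  then obtain m where n: "n = Suc m" by (cases n) auto
  define B where "B = mat_adjoint W * A * W"
  have B: "B \<in> carrier_mat n n" unfolding B_def using A W by auto
  note BA = unitary_similarity_products[OF A W B_def]
  have Bnormal: "mat_adjoint B * B = B * mat_adjoint B" using BA normal by simp
  have "similar_mat_wit B A (mat_adjoint W) W"
    by (rule similar_mat_witI[of _ _ n]) (use A B W unitary_matD[OF W(2,1)] B_def in auto)
  then have "char_poly B = char_poly A" by (intro char_poly_similar) (auto simp: similar_mat_def)
  have AW: "A *\<^sub>v (c \<cdot>\<^sub>v v) = e \<cdot>\<^sub>v (c \<cdot>\<^sub>v v)"
    using A v by (simp add: mult_mat_vec[of _ n n] smult_smult_assoc mult.commute)
  have "col B 0 = (mat_adjoint W * A) *\<^sub>v col W 0"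
    unfolding B_def using A W n by (intro col_mult2) auto
  also have "\<dots> = mat_adjoint W *\<^sub>v (A *\<^sub>v (c \<cdot>\<^sub>v v))" unfolding c using A W v by (simp add: assoc_mult_mat_vec[of _ n n _ n])
  also have "\<dots> = e \<cdot>\<^sub>v (mat_adjoint W *\<^sub>v col W 0)"
    unfolding AW c using W v by (simp add: mult_mat_vec[of _ n n])
  also have "mat_adjoint W *\<^sub>v col W 0 = col (mat_adjoint W * W) 0"
    using W n by (simp add: col_mult2[of _ n n _ n])
  also have "\<dots> = unit_vec n 0" unfolding unitary_matD[OF W(2,1)] using n by simp
  finally have col0: "col B 0 = e \<cdot>\<^sub>v unit_vec n 0" .
  have Bi0: "B $$ (i, 0) = (if i = 0 then e else 0)" if "i < n" for i
    using arg_cong[OF col0, of "\<lambda>v. v $ i"] B n that by auto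
  \<comment> \<open>The \<open>(0, 0)\<close> entries of \<open>B B\<^sup>*\<close> and \<open>B\<^sup>* B\<close> are the squared norms of the first row and of the
    first column. The column has norm \<open>\<bar>e\<bar>\<close>, and \<open>e\<close> already accounts for it in the row.\<close>
  have "(\<Sum>j<n. (cmod (B $$ (0, j)))\<^sup>2) = (cmod e)\<^sup>2"
  proof -
    have "complex_of_real (\<Sum>j<n. (cmod (B $$ (0, j)))\<^sup>2) = (B * mat_adjoint B) $$ (0, 0)"
      using B n by (simp add: index_mult_mat_sum[of _ n n _ n] complex_norm_square
          del: of_real_power index_mult_mat(1))
    also have "\<dots> = (mat_adjoint B * B) $$ (0, 0)" using Bnormal by simp
    also have "\<dots> = (\<Sum>i<n. cnj (B $$ (i, 0)) * B $$ (i, 0))"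
      using B n by (simp add: index_mult_mat_sum[of _ n n _ n] del: index_mult_mat(1))
    also have "\<dots> = (\<Sum>i<n. if i = 0 then e * cnj e else 0)"
      by (rule sum.cong) (auto simp: Bi0)
    also have "\<dots> = complex_of_real ((cmod e)\<^sup>2)"
      using n by (simp add: complex_norm_square del: of_real_power)
    finally show ?thesis by (simp only: of_real_eq_iff)
  qed
  moreover have "(\<Sum>j<n. (cmod (B $$ (0, j)))\<^sup>2)
      = (cmod e)\<^sup>2 + (\<Sum>j<m. (cmod (B $$ (0, Suc j)))\<^sup>2)"
    unfolding n sum.lessThan_Suc_shift using Bi0[of 0] n by simp
  ultimately have "(\<Sum>j<m. (cmod (B $$ (0, Suc j)))\<^sup>2) = 0" by linarith
  then have B0j: "B $$ (0, Suc j) = 0" if "j < m" for j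
    using that by (subst (asm) sum_nonneg_eq_0_iff) auto
  define C where "C = mat m m (\<lambda>(i, j). B $$ (Suc i, Suc j))"
  have C: "C \<in> carrier_mat m m" unfolding C_def by auto
  let ?e = "mat 1 1 (\<lambda>_. e)"
  have BC: "B = four_block_mat ?e (0\<^sub>m 1 m) (0\<^sub>m m 1) C"
  proof (rule eq_matI)
    fix i j assume "i < dim_row (four_block_mat ?e (0\<^sub>m 1 m) (0\<^sub>m m 1) C)"
      "j < dim_col (four_block_mat ?e (0\<^sub>m 1 m) (0\<^sub>m m 1) C)"
    then have "i < n" "j < n" using C n by auto
    then show "B $$ (i, j) = four_block_mat ?e (0\<^sub>m 1 m) (0\<^sub>m m 1) C $$ (i, j)"
      using Bi0[of i] B0j[of "j - 1"] C n unfolding C_def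
      by (cases i; cases j) auto
  qed (use B C n in auto)
  have "[:- e, 1:] * char_poly C = [:- e, 1:] * (\<Prod>e \<leftarrow> es. [:- e, 1:])"
  proof -
    have "char_poly B = char_poly ?e * char_poly C"
      unfolding BC by (rule char_poly_four_block_zeros_col) (use C in auto)
    moreover have "char_poly ?e = [:- e, 1:]"
      by (simp add: char_poly_defs det_def sign_def)
    ultimately show ?thesis using \<open>char_poly B = char_poly A\<close> cp by simp
  qed
  then have cpC: "char_poly C = (\<Prod>e \<leftarrow> es. [:- e, 1:])"
    by (metis mult_cancel_left pCons_eq_0_iff zero_neq_one)
  have Cnormal: "mat_adjoint C * C = C * mat_adjoint C"
  proof (rule eq_matI)
    fix i j assume "i < dim_row (C * mat_adjoint C)" "j < dim_col (C * mat_adjoint C)"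
    then have ij: "i < m" "j < m" using C by auto
    have "(mat_adjoint B * B) $$ (Suc i, Suc j) = (B * mat_adjoint B) $$ (Suc i, Suc j)"
      using Bnormal by simp
    moreover have "(mat_adjoint B * B) $$ (Suc i, Suc j) = (mat_adjoint C * C) $$ (i, j)"
      using B C ij n B0j
      by (simp add: index_mult_mat_sum[of _ n n _ n] index_mult_mat_sum[of _ m m _ m] C_def
          sum.lessThan_Suc_shift del: index_mult_mat(1) sum.lessThan_Suc)
    moreover have "(B * mat_adjoint B) $$ (Suc i, Suc j) = (C * mat_adjoint C) $$ (i, j)"
      using B C ij n Bi0
      by (simp add: index_mult_mat_sum[of _ n n _ n] index_mult_mat_sum[of _ m m _ m] C_def
          sum.lessThan_Suc_shift del: index_mult_mat(1) sum.lessThan_Suc)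
    ultimately show "(mat_adjoint C * C) $$ (i, j) = (C * mat_adjoint C) $$ (i, j)" by simp
  qed (use C in auto)
  from Cons(1)[OF C Cnormal cpC] obtain V where V: "V \<in> carrier_mat m m" "unitary_mat V"
    and CV: "C = diag_conj V (\<lambda>i. es ! i)" by auto
  let ?blk = "\<lambda>X. four_block_mat (1\<^sub>m 1) (0\<^sub>m 1 m) (0\<^sub>m m 1) X :: complex mat"
  have adj: "mat_adjoint (?blk V) = ?blk (mat_adjoint V)"
    by (rule eq_matI) (use V in auto)
  have blk: "?blk V \<in> carrier_mat n n" using V n by auto
  have ublk: "unitary_mat (?blk V)"
  proof (rule unitary_matI[OF blk])
    have "mat_adjoint (?blk V) * ?blk V = ?blk (mat_adjoint V * V)"
      unfolding adj using V by (subst mult_four_block_mat[of _ 1 1 _ m _ m _ _ 1 _ m]) auto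
    also have "\<dots> = 1\<^sub>m n" unfolding unitary_matD[OF V(2,1)] n by (rule eq_matI) auto
    finally show "mat_adjoint (?blk V) * ?blk V = 1\<^sub>m n" .
  qed
  have D: "mat_diag n (\<lambda>i. (e # es) ! i)
      = four_block_mat ?e (0\<^sub>m 1 m) (0\<^sub>m m 1) (mat_diag m (\<lambda>i. es ! i))"
    unfolding mat_diag_def n by (rule eq_matI) (auto simp: nth_Cons split: nat.splits)
  have blk_mult: "four_block_mat X (0\<^sub>m 1 m) (0\<^sub>m m 1) Y * four_block_mat X' (0\<^sub>m 1 m) (0\<^sub>m m 1) Y'
      = four_block_mat (X * X') (0\<^sub>m 1 m) (0\<^sub>m m 1) (Y * Y')"
    if "X \<in> carrier_mat 1 1" "X' \<in> carrier_mat 1 1" "Y \<in> carrier_mat m m" "Y' \<in> carrier_mat m m"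
    for X X' Y Y' :: "complex mat"
    using that mult_carrier_mat[of X 1 1 X' 1] mult_carrier_mat[of Y m m Y' m]
    by (subst mult_four_block_mat[of _ 1 1 _ m _ m _ _ 1 _ m]) auto
  have "B = diag_conj (?blk V) (\<lambda>i. (e # es) ! i)"
  proof -
    have "B = ?blk V * mat_diag n (\<lambda>i. (e # es) ! i) * mat_adjoint (?blk V)"
      unfolding adj D BC CV diag_conj_def using V
      by (simp add: blk_mult mult_carrier_mat[of _ 1 1 _ 1] mult_carrier_mat[of _ m m _ m]
          del: One_nat_def)
    moreover have "dim_row (?blk V) = n" using blk by blast
    ultimately show ?thesis by (simp only: diag_conj_def)
  qed
  then have "A = W * diag_conj (?blk V) (\<lambda>i. (e # es) ! i) * mat_adjoint W"
    using BA(3) by simp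
  also have "\<dots> = diag_conj (W * ?blk V) (\<lambda>i. (e # es) ! i)"
    by (rule conj_diag_conj[OF W(1) blk])
  finally show ?case using unitary_mat_mult[OF W(1) blk W(2) ublk] W blk
    by (intro bexI[of _ "W * ?blk V"] conjI mult_carrier_mat[of _ n n _ n]) auto
qed

section \<open>Calculus in a unitary eigenbasis\<close>

lemma diag_conj_carrier [simp]: "U \<in> carrier_mat n n \<Longrightarrow> diag_conj U d \<in> carrier_mat n n"
  by (auto simp: diag_conj_def)

lemma dim_diag_conj [simp]:
  "dim_row (diag_conj U d) = dim_row U" "dim_col (diag_conj U d) = dim_row U"
  by (auto simp: diag_conj_def)

lemma index_diag_conj:
  assumes "U \<in> carrier_mat n n" "i < n" "j < n"
  shows "diag_conj U d $$ (i, j) = (\<Sum>k<n. U $$ (i, k) * d k * cnj (U $$ (j, k)))"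
  using assms
  by (simp add: diag_conj_def mat_diag_mult_right[of _ n n] index_mult_mat_sum[of _ n n _ n]
      del: index_mult_mat(1))

lemma diag_conj_cong:
  assumes "U \<in> carrier_mat n n" "\<And>k. k < n \<Longrightarrow> d k = e k"
  shows "diag_conj U d = diag_conj U e"
  using assms by (intro eq_matI) (auto simp: index_diag_conj[of _ n])

lemma diag_conj_adjoint:
  assumes "U \<in> carrier_mat n n"
  shows "mat_adjoint (diag_conj U d) = diag_conj U (\<lambda>k. cnj (d k))"
  using assms by (intro eq_matI) (auto simp: index_diag_conj[of _ n] ac_simps)

lemma diag_conj_mult:
  assumes U: "U \<in> carrier_mat n n" "unitary_mat U"
  shows "diag_conj U d * diag_conj U e = diag_conj U (\<lambda>k. d k * e k)"
proof -
  have "diag_conj U d * diag_conj U e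
      = U * mat_diag n d * (mat_adjoint U * U) * (mat_diag n e * mat_adjoint U)"
    using U by (simp add: diag_conj_def assoc_mult_mat[of _ n n _ n _ n]
      mult_carrier_mat[of _ n n _ n])
  also have "\<dots> = U * (mat_diag n d * mat_diag n e) * mat_adjoint U"
    unfolding unitary_matD[OF U(2,1)]
    using U by (simp add: left_mult_one_mat[of _ n n] assoc_mult_mat[of _ n n _ n _ n] mult_carrier_mat[of _ n n _ n]
      del: mat_diag_diag)
  finally show ?thesis using U by (simp add: diag_conj_def)
qed

lemma diag_conj_mult_basis:
  assumes U: "U \<in> carrier_mat n n" "unitary_mat U" and y: "y \<in> carrier_vec n"
  shows "diag_conj U d *\<^sub>v (U *\<^sub>v y) = U *\<^sub>v vec n (\<lambda>k. d k * y $ k)"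
proof -
  have "diag_conj U d *\<^sub>v (U *\<^sub>v y) = U *\<^sub>v (mat_diag n d *\<^sub>v ((mat_adjoint U * U) *\<^sub>v y))"
    using U y by (simp add: diag_conj_def assoc_mult_mat_vec[of _ n n _ n]
      mult_carrier_mat[of _ n n _ n] mult_mat_vec_carrier[of _ n n])
  also have "mat_diag n d *\<^sub>v ((mat_adjoint U * U) *\<^sub>v y) = vec n (\<lambda>k. d k * y $ k)"
  proof (rule eq_vecI)
    fix i assume i: "i < dim_vec (vec n (\<lambda>k. d k * y $ k))"
    then have i': "i < n" by simp
    have "(mat_diag n d *\<^sub>v y) $ i = (\<Sum>k<n. if k = i then d k * y $ k else 0)"
      unfolding index_mult_mat_vec_sum[OF mat_diag_dim y i'] using i' by (intro sum.cong) (auto simp: mat_diag_def)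
    then have "(mat_diag n d *\<^sub>v y) $ i = d i * y $ i" using i by simp
    with i show "(mat_diag n d *\<^sub>v ((mat_adjoint U * U) *\<^sub>v y)) $ i = vec n (\<lambda>k. d k * y $ k) $ i"
      using y by (simp add: unitary_matD[OF U(2,1)] del: index_mult_mat_vec)
  qed (simp add: mat_diag_def)
  finally show ?thesis .
qed

lemma unitary_mult_cancel:
  assumes "U \<in> carrier_mat n n" "unitary_mat U" "x \<in> carrier_vec n"
  shows "U *\<^sub>v (mat_adjoint U *\<^sub>v x) = x" "mat_adjoint U *\<^sub>v (U *\<^sub>v x) = x"
proof -
  have "(U * mat_adjoint U) *\<^sub>v x = x" "(mat_adjoint U * U) *\<^sub>v x = x"
    using assms by (simp_all add: unitary_matD[of _ n])
  then show "U *\<^sub>v (mat_adjoint U *\<^sub>v x) = x" "mat_adjoint U *\<^sub>v (U *\<^sub>v x) = x"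
    using assms by (simp_all add: assoc_mult_mat_vec[of _ n n _ n])
qed

lemma diag_conj_form_basis:
  assumes U: "U \<in> carrier_mat n n" "unitary_mat U" and y: "y \<in> carrier_vec n"
  shows "(diag_conj U d *\<^sub>v (U *\<^sub>v y)) \<bullet>c (U *\<^sub>v y)
      = (\<Sum>k<n. d k * complex_of_real ((cmod (y $ k))\<^sup>2))"
proof -
  have "(diag_conj U d *\<^sub>v (U *\<^sub>v y)) \<bullet>c (U *\<^sub>v y)
      = vec n (\<lambda>k. d k * y $ k) \<bullet>c (mat_adjoint U *\<^sub>v (U *\<^sub>v y))"
    unfolding diag_conj_mult_basis[OF U y]
    using U y by (intro adjoint_cscalar_prod[of _ n n] mult_mat_vec_carrier[of _ n n]) auto
  also have "\<dots> = (\<Sum>k<n. d k * complex_of_real ((cmod (y $ k))\<^sup>2))"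
    using y by (simp add: unitary_mult_cancel[OF U] cscalar_prod_sum[of _ n] complex_norm_square
      mult.assoc del: of_real_power)
  finally show ?thesis .
qed

lemma diag_conj_form:
  assumes U: "U \<in> carrier_mat n n" "unitary_mat U" and x: "x \<in> carrier_vec n"
  shows "(diag_conj U d *\<^sub>v x) \<bullet>c x
      = (\<Sum>k<n. d k * complex_of_real ((cmod ((mat_adjoint U *\<^sub>v x) $ k))\<^sup>2))"
  using diag_conj_form_basis[OF U, of "mat_adjoint U *\<^sub>v x" d] U x
  by (simp add: unitary_mult_cancel[of _ n] mult_mat_vec_carrier[of _ n n] del: index_mult_mat_vec)

lemma nonzero_vec_entry:
  assumes "x \<in> carrier_vec n" "x \<noteq> 0\<^sub>v n"
  obtains i where "i < n" "x $ i \<noteq> 0"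
proof -
  have "\<not> (\<forall>i<n. x $ i = 0)"
  proof
    assume "\<forall>i<n. x $ i = 0"
    then have "x = 0\<^sub>v n" using assms(1) by (intro eq_vecI) auto
    with assms(2) show False ..
  qed
  with that show thesis by blast
qed

lemma eigenvector_diag_conj:
  assumes U: "U \<in> carrier_mat n n" "unitary_mat U" and k: "k < n"
  shows "eigenvector (diag_conj U d) (col U k) (d k)"
proof -
  have col: "col U k = U *\<^sub>v unit_vec n k" using U k by (intro eq_vecI) auto
  have "vec n (\<lambda>i. d i * unit_vec n k $ i) = d k \<cdot>\<^sub>v unit_vec n k"
    using k by (intro eq_vecI) (auto simp: unit_vec_def)
  then have "diag_conj U d *\<^sub>v col U k = d k \<cdot>\<^sub>v col U k"
    unfolding col diag_conj_mult_basis[OF U unit_vec_carrier]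
    using U by (simp add: mult_mat_vec[of _ n n])
  moreover have "col U k \<noteq> 0\<^sub>v n"
  proof
    assume "col U k = 0\<^sub>v n"
    then have "norm_sq (unit_vec n k) = norm_sq (0\<^sub>v n)"
      using norm_sq_unitary[OF U(2,1) unit_vec_carrier, of k] col by simp
    moreover have "norm_sq (0\<^sub>v n) = 0" by (simp add: norm_sq_def)
    moreover have "0 < norm_sq (unit_vec n k)" using k by (intro norm_sq_pos[of _ n]) auto
    ultimately show False by simp
  qed
  ultimately show ?thesis using U k by (auto simp: eigenvector_def)
qed

lemma eigenvalue_diag_conjD:
  assumes U: "U \<in> carrier_mat n n" "unitary_mat U" and "eigenvalue (diag_conj U d) c"
  shows "\<exists>k<n. c = d k"
proof -
  from assms(3) U obtain x where x: "x \<in> carrier_vec n" "x \<noteq> 0\<^sub>v n"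
    and ev: "diag_conj U d *\<^sub>v x = c \<cdot>\<^sub>v x"
    by (auto simp: eigenvalue_def eigenvector_def)
  define y where "y = mat_adjoint U *\<^sub>v x"
  have y: "y \<in> carrier_vec n" unfolding y_def using U x by (intro mult_mat_vec_carrier[of _ n n]) auto
  have xy: "x = U *\<^sub>v y" unfolding y_def using unitary_mult_cancel[OF U x(1)] by simp
  have "y \<noteq> 0\<^sub>v n" using x xy U by auto
  then obtain k where k: "k < n" "y $ k \<noteq> 0" using y nonzero_vec_entry by blast
  have "mat_adjoint U *\<^sub>v (U *\<^sub>v vec n (\<lambda>k. d k * y $ k)) = mat_adjoint U *\<^sub>v (c \<cdot>\<^sub>v (U *\<^sub>v y))"
    using ev xy diag_conj_mult_basis[OF U y, of d] by simp
  then have "vec n (\<lambda>k. d k * y $ k) = c \<cdot>\<^sub>v y"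
    using U y by (simp add: unitary_mult_cancel[of _ n] mult_mat_vec[of _ n n]
      mult_mat_vec_carrier[of _ n n])
  from arg_cong[OF this, of "\<lambda>v. v $ k"] k y have "d k * y $ k = c * y $ k" by simp
  with k show ?thesis by auto
qed

lemma diag_conj_inj:
  assumes U: "U \<in> carrier_mat n n" "unitary_mat U" and eq: "diag_conj U d = diag_conj U e"
    and k: "k < n"
  shows "d k = e k"
proof -
  have "d k \<cdot>\<^sub>v col U k = e k \<cdot>\<^sub>v col U k"
    using eigenvector_diag_conj[OF U k, of d] eigenvector_diag_conj[OF U k, of e] eq
    by (simp add: eigenvector_def)
  then have eq': "(d k \<cdot>\<^sub>v col U k) $ i = (e k \<cdot>\<^sub>v col U k) $ i" for i by simp
  have col: "col U k \<in> carrier_vec n" using U k by auto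
  moreover have "col U k \<noteq> 0\<^sub>v n"
    using eigenvector_diag_conj[OF U k, of d] U by (auto simp: eigenvector_def)
  ultimately obtain i where "i < n" "col U k $ i \<noteq> 0" by (rule nonzero_vec_entry)
  with eq'[of i] U k show ?thesis by simp
qed

section \<open>Hermitian and positive semi-definite matrices\<close>

lemma hermitian_diag_conj:
  assumes "U \<in> carrier_mat n n"
  shows "hermitian_mat (diag_conj U (\<lambda>k. complex_of_real (d k)))"
  using assms by (simp add: hermitian_mat_def diag_conj_adjoint)

text \<open>Every listing of the spectrum, in whatever order, belongs to some unitary eigenbasis; this is
  what links an arbitrary enumeration of the roots of the characteristic polynomial to eigenvectors.
  The listing counts from one, the matrix indices from zero.\<close>

lemma hermitian_eigenbasis:
  assumes A: "A \<in> carrier_mat n n" "hermitian_mat A" and lam: "eigenvalue_listing A lam"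
  obtains U where "U \<in> carrier_mat n n" "unitary_mat U"
    "A = diag_conj U (\<lambda>k. complex_of_real (lam (Suc k)))"
proof -
  let ?es = "map (\<lambda>k. complex_of_real (lam (Suc k))) [0..<n]"
  have "char_poly A = (\<Prod>e \<leftarrow> ?es. [:- e, 1:])"
  proof -
    have "char_poly A = (\<Prod>i\<in>{1..n}. [:- complex_of_real (lam i), 1:])"
      using lam A by (simp add: eigenvalue_listing_def)
    also have "\<dots> = (\<Prod>i\<in>{0..<n}. [:- complex_of_real (lam (Suc i)), 1:])"
      by (rule prod.reindex_bij_witness[of _ Suc "\<lambda>i. i - 1"]) auto
    also have "\<dots> = (\<Prod>e \<leftarrow> ?es. [:- e, 1:])"
      by (simp add: prod.distinct_set_conv_list[of "[0..<n]", simplified] comp_def)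
    finally show ?thesis .
  qed
  moreover have "mat_adjoint A * A = A * mat_adjoint A" using A by (simp add: hermitian_mat_def)
  ultimately obtain U where U: "U \<in> carrier_mat n n" "unitary_mat U"
    and AU: "A = diag_conj U (\<lambda>k. ?es ! k)"
    using normal_unitarily_diagonalisable[OF A(1)] by blast
  have "diag_conj U (\<lambda>k. ?es ! k) = diag_conj U (\<lambda>k. complex_of_real (lam (Suc k)))"
    by (rule diag_conj_cong[OF U(1)]) simp
  with AU that[OF U] show thesis by simp
qed

lemma normal_eigenbasis:
  assumes "A \<in> carrier_mat n n" "mat_adjoint A * A = A * mat_adjoint A"
  obtains U d where "U \<in> carrier_mat n n" "unitary_mat U" "A = diag_conj U d"
proof -
  obtain es where "char_poly A = (\<Prod>e \<leftarrow> es. [:- e, 1:])"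
    using char_poly_factorized[OF assms(1)] by auto
  with that normal_unitarily_diagonalisable[OF assms] show thesis by blast
qed

lemma hermitian_eigenbasis_exists:
  assumes A: "A \<in> carrier_mat n n" "hermitian_mat A"
  obtains U d where "U \<in> carrier_mat n n" "unitary_mat U"
    "A = diag_conj U (\<lambda>k. complex_of_real (d k))"
proof -
  obtain U d where U: "U \<in> carrier_mat n n" "unitary_mat U" and AU: "A = diag_conj U d"
    using normal_eigenbasis[OF A(1)] A(2) by (auto simp: hermitian_mat_def)
  have "diag_conj U d = diag_conj U (\<lambda>k. cnj (d k))"
    using diag_conj_adjoint[OF U(1), of d] A(2) AU by (simp add: hermitian_mat_def)
  from diag_conj_inj[OF U this] have "d k = complex_of_real (Re (d k))" if "k < n" for k
    using that by (metis Reals_cnj_iff of_real_Re)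
  then have "A = diag_conj U (\<lambda>k. complex_of_real (Re (d k)))"
    unfolding AU by (intro diag_conj_cong[OF U(1)])
  with that[OF U] show thesis .
qed

lemma psd_diag_conj:
  assumes U: "U \<in> carrier_mat n n" "unitary_mat U" and "\<And>k. k < n \<Longrightarrow> 0 \<le> d k"
  shows "psd_mat (diag_conj U (\<lambda>k. complex_of_real (d k)))"
  unfolding psd_mat_def
proof (intro conjI ballI hermitian_diag_conj[OF U(1)])
  fix v :: "complex vec" assume "v \<in> carrier_vec (dim_row (diag_conj U (\<lambda>k. complex_of_real (d k))))"
  then have v: "v \<in> carrier_vec n" using U by simp
  have "0 \<le> complex_of_real (\<Sum>k<n. d k * (cmod ((mat_adjoint U *\<^sub>v v) $ k))\<^sup>2)"
    using assms(3) by (auto intro!: sum_nonneg simp: less_eq_complex_def)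
  then show "0 \<le> (diag_conj U (\<lambda>k. complex_of_real (d k)) *\<^sub>v v) \<bullet>c v"
    by (simp add: diag_conj_form[OF U v])
qed

lemma psd_diag_conjD:
  assumes U: "U \<in> carrier_mat n n" "unitary_mat U" and psd: "psd_mat (diag_conj U d)" and k: "k < n"
  shows "0 \<le> d k"
proof -
  have "0 \<le> (diag_conj U d *\<^sub>v (U *\<^sub>v unit_vec n k)) \<bullet>c (U *\<^sub>v unit_vec n k)"
    using psd U by (auto simp: psd_mat_def intro: mult_mat_vec_carrier[of _ n n])
  also have "\<dots> = (\<Sum>i<n. if i = k then d k else 0)"
    unfolding diag_conj_form_basis[OF U unit_vec_carrier]
    using k by (intro sum.cong) auto
  also have "\<dots> = d k" using k by simp
  finally show ?thesis .
qed

lemma psd_eigenbasis: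
  assumes A: "A \<in> carrier_mat n n" "psd_mat A"
  obtains U d where "U \<in> carrier_mat n n" "unitary_mat U"
    "A = diag_conj U (\<lambda>k. complex_of_real (d k))" "\<And>k. k < n \<Longrightarrow> 0 \<le> d k"
proof -
  obtain U d where U: "U \<in> carrier_mat n n" "unitary_mat U"
    and AU: "A = diag_conj U (\<lambda>k. complex_of_real (d k))"
    using A by (auto simp: psd_mat_def elim: hermitian_eigenbasis_exists[of A n])
  have "0 \<le> d k" if "k < n" for k
    using psd_diag_conjD[OF U A(2)[unfolded AU] that] by (simp add: less_eq_complex_def)
  with that U AU show thesis by blast
qed

lemma psd_adjoint_mult:
  assumes A: "A \<in> carrier_mat n n"
  shows "psd_mat (mat_adjoint A * A)"
  unfolding psd_mat_def hermitian_mat_def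
proof (intro conjI ballI)
  show "mat_adjoint (mat_adjoint A * A) = mat_adjoint A * A"
    using A by (simp add: mat_adjoint_mult[of _ n n _ n])
  fix v :: "complex vec" assume "v \<in> carrier_vec (dim_row (mat_adjoint A * A))"
  then have eq: "complex_of_real (norm_sq (A *\<^sub>v v)) = ((mat_adjoint A * A) *\<^sub>v v) \<bullet>c v"
    using A by (intro norm_sq_adjoint) auto
  have "0 \<le> complex_of_real (norm_sq (A *\<^sub>v v))" by (simp add: less_eq_complex_def)
  then show "0 \<le> ((mat_adjoint A * A) *\<^sub>v v) \<bullet>c v" by (simp only: eq)
qed (use A in auto)

text \<open>It suffices to compare the two matrices on an eigenbasis of one of them.\<close>

lemma psd_sqrt_unique:
  assumes P: "P \<in> carrier_mat n n" "psd_mat P" and Q: "Q \<in> carrier_mat n n" "psd_mat Q"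
    and eq: "P * P = Q * Q"
  shows "P = Q"
proof -
  obtain U p where U: "U \<in> carrier_mat n n" "unitary_mat U"
    and PU: "P = diag_conj U (\<lambda>k. complex_of_real (p k))" and p: "\<And>k. k < n \<Longrightarrow> 0 \<le> p k"
    by (rule psd_eigenbasis[OF P]) blast
  obtain V q where V: "V \<in> carrier_mat n n" "unitary_mat V"
    and QV: "Q = diag_conj V (\<lambda>k. complex_of_real (q k))" and q: "\<And>k. k < n \<Longrightarrow> 0 \<le> q k"
    by (rule psd_eigenbasis[OF Q]) blast
  \<comment> \<open>On an eigenvector of \<open>P\<close> the two square roots agree, coordinate by coordinate in the
    eigenbasis of \<open>Q\<close>, because \<open>q\<^sup>2 = p\<^sup>2\<close> forces \<open>q = p\<close> for nonnegative numbers.\<close>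
  have cols: "P *\<^sub>v col U k = Q *\<^sub>v col U k" if k: "k < n" for k
  proof -
    define y where "y = mat_adjoint V *\<^sub>v col U k"
    have c: "col U k \<in> carrier_vec n" using U k by auto
    have y: "y \<in> carrier_vec n" unfolding y_def using V c by (intro mult_mat_vec_carrier[of _ n n]) auto
    have Vy: "col U k = V *\<^sub>v y" unfolding y_def using unitary_mult_cancel[OF V c] by simp
    have "(Q * Q) *\<^sub>v (V *\<^sub>v y) = (P * P) *\<^sub>v col U k" using eq Vy by simp
    also have "\<dots> = complex_of_real (p k * p k) \<cdot>\<^sub>v (V *\<^sub>v y)"
      using eigenvector_diag_conj[OF U k] unfolding PU diag_conj_mult[OF U] eigenvector_def Vy
      by auto
    finally have Veq: "V *\<^sub>v vec n (\<lambda>i. complex_of_real (q i * q i) * y $ i)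
        = V *\<^sub>v (complex_of_real (p k * p k) \<cdot>\<^sub>v y)"
      unfolding QV diag_conj_mult[OF V] diag_conj_mult_basis[OF V y]
      using V y by (simp add: mult_mat_vec[of _ n n])
    have "complex_of_real (p k * p k) \<cdot>\<^sub>v y \<in> carrier_vec n" using y by simp
    from arg_cong[OF Veq, of "\<lambda>v. mat_adjoint V *\<^sub>v v"]
      unitary_mult_cancel(2)[OF V this] unitary_mult_cancel(2)[OF V vec_carrier]
    have "vec n (\<lambda>i. complex_of_real (q i * q i) * y $ i) = complex_of_real (p k * p k) \<cdot>\<^sub>v y"
      by (simp only:)
    then have idx: "vec n (\<lambda>i. complex_of_real (q i * q i) * y $ i) $ i
        = (complex_of_real (p k * p k) \<cdot>\<^sub>v y) $ i" for i by simp
    have sq: "complex_of_real (q i * q i) * y $ i = complex_of_real (p k * p k) * y $ i"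
      if "i < n" for i using idx[of i] that y by simp
    have lin: "complex_of_real (q i) * y $ i = complex_of_real (p k) * y $ i" if i: "i < n" for i
    proof (cases "y $ i = 0")
      case False
      with sq[OF i] have "q i * q i = p k * p k" by (simp flip: of_real_mult)
      with p[OF k] q[OF i] have "q i = p k" by (simp add: power2_eq_iff_nonneg flip: power2_eq_square)
      then show ?thesis by simp
    qed simp
    have "Q *\<^sub>v (V *\<^sub>v y) = V *\<^sub>v (complex_of_real (p k) \<cdot>\<^sub>v y)"
      unfolding QV diag_conj_mult_basis[OF V y] using lin y
      by (intro arg_cong[of _ _ "\<lambda>v. V *\<^sub>v v"] eq_vecI) auto
    also have "\<dots> = complex_of_real (p k) \<cdot>\<^sub>v col U k" using V y Vy by (simp add: mult_mat_vec[of _ n n])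
    also have "\<dots> = P *\<^sub>v col U k"
      using eigenvector_diag_conj[OF U k] unfolding PU eigenvector_def by auto
    finally show ?thesis using Vy by simp
  qed
  have "P * U = Q * U"
  proof (rule mat_col_eqI)
    fix k assume "k < dim_col (Q * U)"
    then show "col (P * U) k = col (Q * U) k"
      using cols[of k] col_mult2[OF P(1) U(1)] col_mult2[OF Q(1) U(1)] U by simp
  qed (use P Q U in auto)
  then have "(P * U) * mat_adjoint U = (Q * U) * mat_adjoint U" by simp
  then show ?thesis
    using P Q U by (simp add: assoc_mult_mat[of _ n n _ n _ n] unitary_matD[of _ n])
qed

lemma psd_sqrt_eqI:
  assumes "P \<in> carrier_mat n n" "psd_mat P" "P * P = B"
  shows "psd_sqrt B = P"
  unfolding psd_sqrt_def
proof (rule the_equality)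
  have n: "dim_row B = n" using assms by auto
  show "P \<in> carrier_mat (dim_row B) (dim_row B) \<and> psd_mat P \<and> P * P = B"
    unfolding n using assms by simp
  fix Q assume "Q \<in> carrier_mat (dim_row B) (dim_row B) \<and> psd_mat Q \<and> Q * Q = B"
  then show "Q = P" unfolding n using assms by (intro psd_sqrt_unique[of Q n P]) simp_all
qed

lemma psd_sqrt_props:
  assumes B: "B \<in> carrier_mat n n" "psd_mat B"
  shows "psd_sqrt B \<in> carrier_mat n n" "psd_mat (psd_sqrt B)"
proof -
  obtain U d where U: "U \<in> carrier_mat n n" "unitary_mat U"
    and BU: "B = diag_conj U (\<lambda>k. complex_of_real (d k))" and d: "\<And>k. k < n \<Longrightarrow> 0 \<le> d k"
    by (rule psd_eigenbasis[OF B]) blast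
  let ?R = "diag_conj U (\<lambda>k. complex_of_real (sqrt (d k)))"
  have "?R * ?R = B"
    unfolding diag_conj_mult[OF U] BU
    using d by (intro diag_conj_cong[OF U(1)]) (simp flip: of_real_mult)
  moreover have "psd_mat ?R" using d by (intro psd_diag_conj[OF U]) auto
  ultimately have "psd_sqrt B = ?R" using U by (intro psd_sqrt_eqI) auto
  then show "psd_sqrt B \<in> carrier_mat n n" "psd_mat (psd_sqrt B)"
    using U \<open>psd_mat ?R\<close> by auto
qed

text \<open>The right-hand side is a positive semi-definite square root of \<open>A\<^sup>* A\<close>, and there is only one. Hence
  the eigenvectors of \<open>A\<close> for nonzero eigenvalues lie in the range of its polar factor.\<close>

lemma polar_factor_diag_conj:
  assumes U: "U \<in> carrier_mat n n" "unitary_mat U"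
  shows "polar_factor (diag_conj U (\<lambda>k. complex_of_real (d k)))
      = diag_conj U (\<lambda>k. complex_of_real \<bar>d k\<bar>)"
  unfolding polar_factor_def
proof (rule psd_sqrt_eqI[of _ n])
  show "psd_mat (diag_conj U (\<lambda>k. complex_of_real \<bar>d k\<bar>))" by (intro psd_diag_conj[OF U]) auto
  have "\<bar>x\<bar> * \<bar>x\<bar> = x * x" for x :: real by (simp add: abs_mult_self_eq)
  then show "diag_conj U (\<lambda>k. complex_of_real \<bar>d k\<bar>) * diag_conj U (\<lambda>k. complex_of_real \<bar>d k\<bar>)
      = mat_adjoint (diag_conj U (\<lambda>k. complex_of_real (d k))) * diag_conj U (\<lambda>k. complex_of_real (d k))"
    unfolding diag_conj_adjoint[OF U(1)] diag_conj_mult[OF U] complex_cnj_complex_of_real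
      of_real_mult[symmetric] by simp
qed (use U in auto)

section \<open>Pseudo-inverses\<close>

text \<open>The Penrose conditions determine the projections \<open>A X\<close> and \<open>X A\<close>: both \<open>A X\<close> and \<open>A Y\<close> are
  Hermitian, each absorbs the other on the left, and taking adjoints of such a relation reverses its order. The
  matrix \<open>X = X A X\<close> is then determined as well.\<close>

lemma pseudo_inverse_unique:
  assumes "is_pseudo_inverse A X" "is_pseudo_inverse A Y"
  shows "X = Y"
proof -
  define m n where "m = dim_row A" and "n = dim_col A"
  note [simp] = mult_carrier_mat[of _ n m _ n] mult_carrier_mat[of _ m n _ m]
  have A: "A \<in> carrier_mat m n" by (simp add: m_def n_def)
  have X: "X \<in> carrier_mat n m" "A * X * A = A" "X * A * X = X"
    "mat_adjoint (A * X) = A * X" "mat_adjoint (X * A) = X * A"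
    using assms(1) by (auto simp: is_pseudo_inverse_def m_def n_def)
  have Y: "Y \<in> carrier_mat n m" "A * Y * A = A" "Y * A * Y = Y"
    "mat_adjoint (A * Y) = A * Y" "mat_adjoint (Y * A) = Y * A"
    using assms(2) by (auto simp: is_pseudo_inverse_def m_def n_def)
  have "A * X = (A * Y) * (A * X)"
    using assoc_mult_mat[of "A * Y" m m A n X m] A X Y by simp
  also have "\<dots> = mat_adjoint ((A * X) * (A * Y))"
    using mat_adjoint_mult[of "A * X" m m "A * Y" m] A X Y by simp
  also have "(A * X) * (A * Y) = A * Y"
    using assoc_mult_mat[of "A * X" m m A n Y m] A X Y by simp
  finally have AX: "A * X = A * Y" using Y by simp
  have "X * A = (X * A) * (Y * A)"
    using assoc_mult_mat[of X n m A n "Y * A" n] assoc_mult_mat[of A m n Y m A n] A X Y by simp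
  also have "\<dots> = mat_adjoint ((Y * A) * (X * A))"
    using mat_adjoint_mult[of "Y * A" n n "X * A" n] A X Y by simp
  also have "(Y * A) * (X * A) = Y * A"
    using assoc_mult_mat[of Y n m A n "X * A" n] assoc_mult_mat[of A m n X m A n] A X Y by simp
  finally have XA: "X * A = Y * A" using Y by simp
  have "X = Y * A * X" using X XA by simp
  also have "\<dots> = Y * (A * Y)" using A X Y AX by (simp add: assoc_mult_mat[of _ n m _ n _ m])
  also have "\<dots> = Y" using A Y by (simp add: assoc_mult_mat[of _ n m _ n _ m])
  finally show ?thesis .
qed

lemma pseudo_inverse_eqI: "is_pseudo_inverse A X \<Longrightarrow> pseudo_inverse A = X"
  unfolding pseudo_inverse_def using pseudo_inverse_unique by (intro the_equality) auto

text \<open>The convention that the inverse of zero is zero makes the reciprocals of the eigenvalues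
  exactly those of the pseudo-inverse.\<close>

lemma pseudo_inverse_diag_conj_unitary:
  assumes V: "V \<in> carrier_mat n n" "unitary_mat V" and S: "S \<in> carrier_mat n n" "unitary_mat S"
  shows "pseudo_inverse (diag_conj V (\<lambda>k. complex_of_real (a k)) * S)
      = mat_adjoint S * diag_conj V (\<lambda>k. complex_of_real (inverse (a k)))" (is ?left)
    and "pseudo_inverse (S * diag_conj V (\<lambda>k. complex_of_real (a k)))
      = diag_conj V (\<lambda>k. complex_of_real (inverse (a k))) * mat_adjoint S" (is ?right)
proof -
  note [simp] = mat_adjoint_mult[of _ n n _ n] assoc_mult_mat[of _ n n _ n _ n]
    mult_carrier_mat[of _ n n _ n]
  define P where "P = diag_conj V (\<lambda>k. complex_of_real (a k))"
  define R where "R = diag_conj V (\<lambda>k. complex_of_real (inverse (a k)))"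
  define Q where "Q = diag_conj V (\<lambda>k. complex_of_real (if a k = 0 then 0 else 1))"
  have car: "P \<in> carrier_mat n n" "R \<in> carrier_mat n n" "Q \<in> carrier_mat n n"
    using V by (auto simp: P_def R_def Q_def)
  have dims: "dim_row P = n" "dim_col P = n" "dim_row R = n" "dim_col R = n"
    "dim_row S = n" "dim_col S = n" using car S by auto
  have PR: "P * R = Q" "R * P = Q" "Q * P = P" "P * Q = P" "R * Q = R" "Q * R = R"
    unfolding P_def R_def Q_def diag_conj_mult[OF V]
    by (intro diag_conj_cong[OF V(1)]; simp)+
  have adjQ: "mat_adjoint Q = Q" unfolding Q_def by (simp add: diag_conj_adjoint[OF V(1)])
  have S1: "S * (mat_adjoint S * X) = X" "mat_adjoint S * (S * X) = X" if "X \<in> carrier_mat n n" for X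
  proof -
    have "(S * mat_adjoint S) * X = X" "(mat_adjoint S * S) * X = X"
      unfolding unitary_matD[OF S(2,1)] using that by auto
    then show "S * (mat_adjoint S * X) = X" "mat_adjoint S * (S * X) = X" using S that by simp_all
  qed
  have PR': "P * (R * X) = Q * X" "R * (P * X) = Q * X" "Q * (P * X) = P * X"
    "P * (Q * X) = P * X" "Q * (R * X) = R * X" if "X \<in> carrier_mat n n" for X
    using PR that car by (simp_all flip: assoc_mult_mat[of _ n n _ n _ n])
  note facts = car dims S PR PR' S1 adjQ unitary_matD[OF S(2,1)]
  have "is_pseudo_inverse (P * S) (mat_adjoint S * R)"
    unfolding is_pseudo_inverse_def by (simp add: facts)
  then show ?left unfolding P_def R_def by (rule pseudo_inverse_eqI)
  have "is_pseudo_inverse (S * P) (R * mat_adjoint S)"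
    unfolding is_pseudo_inverse_def by (simp add: facts)
  then show ?right unfolding P_def R_def by (rule pseudo_inverse_eqI)
qed

section \<open>Norm bounds\<close>

text \<open>The matrix \<open>C\<^sup>* C\<close> is diagonal in a unitary basis, and its eigenvalues are the squares of the
  singular values. A positive size ensures that there is a singular value at all.\<close>

lemma mat_norm2_bound:
  assumes C: "C \<in> carrier_mat n n" and n: "0 < n"
  shows "0 \<le> mat_norm2 C"
    and "x \<in> carrier_vec n \<Longrightarrow> norm_sq (C *\<^sub>v x) \<le> (mat_norm2 C)\<^sup>2 * norm_sq x"
proof -
  have "mat_adjoint C * C \<in> carrier_mat n n" using C by (intro mult_carrier_mat[of _ n n _ n]) auto
  then obtain U c where U: "U \<in> carrier_mat n n" "unitary_mat U"
    and CU: "mat_adjoint C * C = diag_conj U (\<lambda>k. complex_of_real (c k))"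
    and c: "\<And>k. k < n \<Longrightarrow> 0 \<le> c k"
    by (rule psd_eigenbasis[OF _ psd_adjoint_mult[OF C]]) blast
  have sv: "singular_values C = (\<lambda>k. sqrt (c k)) ` {..<n}"
  proof
    show "singular_values C \<subseteq> (\<lambda>k. sqrt (c k)) ` {..<n}"
      unfolding singular_values_def CU using eigenvalue_diag_conjD[OF U] by fastforce
    show "(\<lambda>k. sqrt (c k)) ` {..<n} \<subseteq> singular_values C"
    proof
      fix s assume "s \<in> (\<lambda>k. sqrt (c k)) ` {..<n}"
      then obtain k where k: "k < n" "s = sqrt (Re (complex_of_real (c k)))" by auto
      have "eigenvalue (mat_adjoint C * C) (complex_of_real (c k))"
        unfolding CU eigenvalue_def using eigenvector_diag_conj[OF U k(1)] by blast
      with k(2) show "s \<in> singular_values C" unfolding singular_values_def by blast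
    qed
  qed
  have le: "sqrt (c k) \<le> mat_norm2 C" if "k < n" for k
    unfolding mat_norm2_def sv using that by (intro Max_ge) auto
  show nn: "0 \<le> mat_norm2 C" using le[OF n] c[OF n] by (meson order_trans real_sqrt_ge_zero)
  show "norm_sq (C *\<^sub>v x) \<le> (mat_norm2 C)\<^sup>2 * norm_sq x" if x: "x \<in> carrier_vec n"
  proof -
    let ?w = "mat_adjoint U *\<^sub>v x"
    have w: "?w \<in> carrier_vec n" using U x by (intro mult_mat_vec_carrier[of _ n n]) auto
    have "complex_of_real (norm_sq (C *\<^sub>v x)) = complex_of_real (\<Sum>k<n. c k * (cmod (?w $ k))\<^sup>2)"
      unfolding norm_sq_adjoint[OF C x] CU diag_conj_form[OF U x] by simp
    then have "norm_sq (C *\<^sub>v x) = (\<Sum>k<n. c k * (cmod (?w $ k))\<^sup>2)" by (simp only: of_real_eq_iff)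
    also have "\<dots> \<le> (\<Sum>k<n. (mat_norm2 C)\<^sup>2 * (cmod (?w $ k))\<^sup>2)"
    proof (intro sum_mono mult_right_mono)
      fix k assume "k \<in> {..<n}"
      then have k: "k < n" by simp
      have "c k = (sqrt (c k))\<^sup>2" using c[OF k] by simp
      also have "\<dots> \<le> (mat_norm2 C)\<^sup>2" using le[OF k] c[OF k] by (intro power_mono) auto
      finally show "c k \<le> (mat_norm2 C)\<^sup>2" .
    qed simp
    also have "\<dots> = (mat_norm2 C)\<^sup>2 * norm_sq ?w"
      using w by (simp add: norm_sq_def sum_distrib_left del: dim_mult_mat_vec index_mult_mat_vec)
    also have "norm_sq ?w = norm_sq x"
      using U x by (intro norm_sq_unitary[of _ n] unitary_mat_adjoint) auto
    finally show ?thesis .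
  qed
qed

lemma hermitian_form_bound:
  assumes H: "H \<in> carrier_mat n n" "hermitian_mat H" and x: "x \<in> carrier_vec n"
    and ev: "\<And>c. eigenvalue H c \<Longrightarrow> cmod c \<le> k"
  shows "cmod ((H *\<^sub>v x) \<bullet>c x) \<le> k * norm_sq x"
proof -
  obtain U d where U: "U \<in> carrier_mat n n" "unitary_mat U"
    and HU: "H = diag_conj U (\<lambda>k. complex_of_real (d k))"
    by (rule hermitian_eigenbasis_exists[OF H]) blast
  let ?w = "mat_adjoint U *\<^sub>v x"
  have w: "?w \<in> carrier_vec n" using U x by (intro mult_mat_vec_carrier[of _ n n]) auto
  have "cmod ((H *\<^sub>v x) \<bullet>c x) \<le> (\<Sum>i<n. cmod (complex_of_real (d i) * complex_of_real ((cmod (?w $ i))\<^sup>2)))"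
    unfolding HU diag_conj_form[OF U x] by (rule norm_sum)
  also have "\<dots> \<le> (\<Sum>i<n. k * (cmod (?w $ i))\<^sup>2)"
  proof (rule sum_mono)
    fix i assume "i \<in> {..<n}"
    then have i: "i < n" by simp
    have "eigenvalue H (complex_of_real (d i))"
      unfolding HU eigenvalue_def using eigenvector_diag_conj[OF U i] by blast
    from mult_right_mono[OF ev[OF this], of "(cmod (?w $ i))\<^sup>2"]
    show "cmod (complex_of_real (d i) * complex_of_real ((cmod (?w $ i))\<^sup>2)) \<le> k * (cmod (?w $ i))\<^sup>2"
      by (simp add: norm_mult norm_power del: index_mult_mat_vec)
  qed
  also have "\<dots> = k * norm_sq ?w"
    using w by (simp add: norm_sq_def sum_distrib_left del: dim_mult_mat_vec index_mult_mat_vec)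
  also have "norm_sq ?w = norm_sq x"
    using U x by (intro norm_sq_unitary[of _ n] unitary_mat_adjoint) auto
  finally show ?thesis .
qed

section \<open>Simultaneous diagonalisation\<close>

text \<open>The matrix \<open>N = P\<^sub>1 + \<i> P\<^sub>2\<close> is normal because \<open>P\<^sub>1\<close> and \<open>P\<^sub>2\<close> commute, and its Hermitian
  and skew-Hermitian parts are \<open>P\<^sub>1\<close> and \<open>\<i> P\<^sub>2\<close>. A unitary eigenbasis of \<open>N\<close> therefore diagonalises both, with the
  real and imaginary parts of the eigenvalues of \<open>N\<close> as eigenvalues.\<close>

lemma commuting_psd_eigenbasis:
  assumes P1: "P1 \<in> carrier_mat n n" "psd_mat P1" and P2: "P2 \<in> carrier_mat n n" "psd_mat P2"
    and comm: "P1 * P2 = P2 * P1"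
  obtains V a b where "V \<in> carrier_mat n n" "unitary_mat V"
    "P1 = diag_conj V (\<lambda>k. complex_of_real (a k))" "P2 = diag_conj V (\<lambda>k. complex_of_real (b k))"
    "\<And>k. k < n \<Longrightarrow> 0 \<le> a k" "\<And>k. k < n \<Longrightarrow> 0 \<le> b k"
proof -
  have adj: "mat_adjoint P1 = P1" "mat_adjoint P2 = P2"
    using P1 P2 by (auto simp: psd_mat_def hermitian_mat_def)
  define N where "N = P1 + \<i> \<cdot>\<^sub>m P2"
  have N: "N \<in> carrier_mat n n" unfolding N_def using P1 P2 by auto
  have entry: "cnj (P1 $$ (j, i)) = P1 $$ (i, j)" "cnj (P2 $$ (j, i)) = P2 $$ (i, j)"
    if "i < n" "j < n" for i j
    using index_mat_adjoint[of i P1 j] index_mat_adjoint[of i P2 j] P1 P2 that adj by auto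
  have adjN: "mat_adjoint N = P1 - \<i> \<cdot>\<^sub>m P2"
    unfolding N_def using P1 P2 entry by (intro eq_matI) auto
  have "mat_adjoint N * N = N * mat_adjoint N"
  proof (rule eq_matI)
    fix i j assume "i < dim_row (N * mat_adjoint N)" "j < dim_col (N * mat_adjoint N)"
    then have ij: "i < n" "j < n" using N by auto
    have "(P1 * P2) $$ (i, j) = (P2 * P1) $$ (i, j)" using comm by simp
    then have "(\<Sum>k<n. P1 $$ (i, k) * P2 $$ (k, j)) = (\<Sum>k<n. P2 $$ (i, k) * P1 $$ (k, j))"
      using P1 P2 ij by (simp add: index_mult_mat_sum[of _ n n _ n] del: index_mult_mat(1))
    moreover have "(mat_adjoint N * N) $$ (i, j)
        = (\<Sum>k<n. (P1 $$ (i, k) - \<i> * P2 $$ (i, k)) * (P1 $$ (k, j) + \<i> * P2 $$ (k, j)))"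
      using P1 P2 ij unfolding index_mult_mat_sum[OF mat_adjoint_carrier[OF N] N ij]
      by (intro sum.cong) (auto simp: adjN, simp add: N_def)
    moreover have "(N * mat_adjoint N) $$ (i, j)
        = (\<Sum>k<n. (P1 $$ (i, k) + \<i> * P2 $$ (i, k)) * (P1 $$ (k, j) - \<i> * P2 $$ (k, j)))"
      using P1 P2 ij unfolding index_mult_mat_sum[OF N mat_adjoint_carrier[OF N] ij]
      by (intro sum.cong) (auto simp: adjN, simp add: N_def)
    ultimately show "(mat_adjoint N * N) $$ (i, j) = (N * mat_adjoint N) $$ (i, j)"
      by (simp add: algebra_simps sum.distrib sum_subtractf flip: sum_distrib_left)
  qed (use N in auto)
  then obtain V d where V: "V \<in> carrier_mat n n" "unitary_mat V" and NV: "N = diag_conj V d"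
    by (rule normal_eigenbasis[OF N]) blast
  have ent: "P1 $$ (i, j) + \<i> * P2 $$ (i, j) = (\<Sum>k<n. V $$ (i, k) * d k * cnj (V $$ (j, k)))"
    "P1 $$ (i, j) - \<i> * P2 $$ (i, j) = (\<Sum>k<n. V $$ (i, k) * cnj (d k) * cnj (V $$ (j, k)))"
    if ij: "i < n" "j < n" for i j
  proof -
    have "N $$ (i, j) = P1 $$ (i, j) + \<i> * P2 $$ (i, j)" unfolding N_def using P1 P2 ij by simp
    then show "P1 $$ (i, j) + \<i> * P2 $$ (i, j) = (\<Sum>k<n. V $$ (i, k) * d k * cnj (V $$ (j, k)))"
      using index_diag_conj[OF V(1) ij, of d] NV by simp
    have "mat_adjoint N $$ (i, j) = P1 $$ (i, j) - \<i> * P2 $$ (i, j)"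
      unfolding adjN using P1 P2 ij by simp
    then show "P1 $$ (i, j) - \<i> * P2 $$ (i, j) = (\<Sum>k<n. V $$ (i, k) * cnj (d k) * cnj (V $$ (j, k)))"
      using index_diag_conj[OF V(1) ij, of "\<lambda>k. cnj (d k)"] NV diag_conj_adjoint[OF V(1), of d] by simp
  qed
  have P1V: "P1 = diag_conj V (\<lambda>k. complex_of_real (Re (d k)))"
  proof (rule eq_matI)
    fix i j assume "i < dim_row (diag_conj V (\<lambda>k. complex_of_real (Re (d k))))"
      "j < dim_col (diag_conj V (\<lambda>k. complex_of_real (Re (d k))))"
    then have ij: "i < n" "j < n" using V by auto
    have "2 * P1 $$ (i, j) = (P1 $$ (i, j) + \<i> * P2 $$ (i, j)) + (P1 $$ (i, j) - \<i> * P2 $$ (i, j))" by simp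
    also have "\<dots> = (\<Sum>k<n. V $$ (i, k) * (d k + cnj (d k)) * cnj (V $$ (j, k)))"
      unfolding ent[OF ij] by (simp add: sum.distrib algebra_simps)
    also have "\<dots> = 2 * (\<Sum>k<n. V $$ (i, k) * complex_of_real (Re (d k)) * cnj (V $$ (j, k)))"
      by (simp add: complex_add_cnj sum_distrib_left mult_ac)
    finally show "P1 $$ (i, j) = diag_conj V (\<lambda>k. complex_of_real (Re (d k))) $$ (i, j)"
      by (simp add: index_diag_conj[OF V(1) ij])
  qed (use P1 V in auto)
  have P2V: "P2 = diag_conj V (\<lambda>k. complex_of_real (Im (d k)))"
  proof (rule eq_matI)
    fix i j assume "i < dim_row (diag_conj V (\<lambda>k. complex_of_real (Im (d k))))"
      "j < dim_col (diag_conj V (\<lambda>k. complex_of_real (Im (d k))))"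
    then have ij: "i < n" "j < n" using V by auto
    have "2 * \<i> * P2 $$ (i, j) = (P1 $$ (i, j) + \<i> * P2 $$ (i, j)) - (P1 $$ (i, j) - \<i> * P2 $$ (i, j))" by simp
    also have "\<dots> = (\<Sum>k<n. V $$ (i, k) * (d k - cnj (d k)) * cnj (V $$ (j, k)))"
      unfolding ent[OF ij] by (simp add: sum_subtractf algebra_simps)
    also have "\<dots> = 2 * \<i> * (\<Sum>k<n. V $$ (i, k) * complex_of_real (Im (d k)) * cnj (V $$ (j, k)))"
      by (simp add: complex_diff_cnj sum_distrib_left mult_ac)
    finally show "P2 $$ (i, j) = diag_conj V (\<lambda>k. complex_of_real (Im (d k))) $$ (i, j)"
      by (simp add: index_diag_conj[OF V(1) ij])
  qed (use P2 V in auto)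
  have "0 \<le> Re (d k)" "0 \<le> Im (d k)" if "k < n" for k
    using psd_diag_conjD[OF V P1(2)[unfolded P1V] that] psd_diag_conjD[OF V P2(2)[unfolded P2V] that]
    by (simp_all add: less_eq_complex_def)
  with that[OF V P1V P2V] show thesis by blast
qed

section \<open>The relative bound\<close>

text \<open>Let \<open>P\<^sub>1\<close> and \<open>P\<^sub>2\<close> be the matrices with eigenvalues \<open>a\<close> and \<open>b\<close>. The Cauchy-Schwarz inequality for
  \<open>(P\<^sub>1 x)\<^sup>* M (P\<^sub>2 x) = x\<^sup>* E x\<close> bounds the form by
  \<open>k \<parallel>P\<^sub>1 x\<parallel> \<parallel>P\<^sub>2 x\<parallel>\<close>, which is too large in general. Instead, the form of \<open>E\<close> at \<open>x\<close> is the form of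
  \<open>H = P\<^sup>+\<^sup>1\<^sup>/\<^sup>2 E P\<^sup>+\<^sup>1\<^sup>/\<^sup>2\<close> at \<open>P\<^sup>1\<^sup>/\<^sup>2 x\<close>. On the range of \<open>P\<close>, the Hermitian matrix \<open>H\<close> is similar to the
  compression of \<open>M\<close>, through the positive diagonal matrix with entries \<open>sqrt (a i / b i)\<close>. Its
  eigenvalues are therefore bounded by the norm of \<open>M\<close>, and for a Hermitian matrix
  that bounds the form. The vector \<open>x\<close> must lie in the range of \<open>P\<close>, because \<open>M\<close> retains nothing of \<open>E\<close> on the
  kernels of \<open>P\<^sub>1\<close> and \<open>P\<^sub>2\<close>.\<close>

lemma relative_form_bound:
  fixes a b :: "nat \<Rightarrow> real"
  assumes V: "V \<in> carrier_mat n n" "unitary_mat V"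
    and a: "\<And>i. i < n \<Longrightarrow> 0 \<le> a i" and b: "\<And>i. i < n \<Longrightarrow> 0 \<le> b i"
    and E: "E \<in> carrier_mat n n" "hermitian_mat E" and k: "0 \<le> k"
    and M: "M = diag_conj V (\<lambda>i. complex_of_real (inverse (a i))) * E
      * diag_conj V (\<lambda>i. complex_of_real (inverse (b i)))"
    and norm_M: "\<And>x. x \<in> carrier_vec n \<Longrightarrow> norm_sq (M *\<^sub>v x) \<le> k\<^sup>2 * norm_sq x"
    and P: "P = diag_conj V (\<lambda>i. complex_of_real (a i * b i))"
    and y: "y \<in> carrier_vec n" and x: "x = P *\<^sub>v y"
  shows "cmod ((E *\<^sub>v x) \<bullet>c x) \<le> k * Re ((P *\<^sub>v x) \<bullet>c x)"
proof -
  note [simp] = assoc_mult_mat[of _ n n _ n _ n] mult_carrier_mat[of _ n n _ n]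
    assoc_mult_mat_vec[of _ n n _ n] mult_mat_vec_carrier[of _ n n]
  let ?dc = "\<lambda>f. diag_conj V (\<lambda>i. complex_of_real (f i))"
  define R1 where "R1 = ?dc (\<lambda>i. inverse (a i))"
  define R2 where "R2 = ?dc (\<lambda>i. inverse (b i))"
  define D where "D = ?dc (\<lambda>i. sqrt (a i / b i))"
  define D' where "D' = ?dc (\<lambda>i. sqrt (b i / a i))"
  define G where "G = ?dc (\<lambda>i. inverse (sqrt (a i * b i)))"
  define T where "T = ?dc (\<lambda>i. sqrt (a i * b i))"
  define Q where "Q = ?dc (\<lambda>i. if a i * b i = 0 then 0 else 1)"
  have car: "R1 \<in> carrier_mat n n" "R2 \<in> carrier_mat n n" "D \<in> carrier_mat n n" "D' \<in> carrier_mat n n"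
    "G \<in> carrier_mat n n" "T \<in> carrier_mat n n" "Q \<in> carrier_mat n n" "P \<in> carrier_mat n n"
    using V by (auto simp: R1_def R2_def D_def D'_def G_def T_def Q_def P)
  have mult: "?dc f * ?dc g = ?dc h" if "\<And>i. i < n \<Longrightarrow> f i * g i = h i" for f g h :: "nat \<Rightarrow> real"
    unfolding diag_conj_mult[OF V]
    using that by (intro diag_conj_cong[OF V(1)]) (simp flip: of_real_mult)
  have herm: "mat_adjoint (?dc f) = ?dc f" for f by (simp add: diag_conj_adjoint[OF V(1)])
  have DR: "D * R1 = G" unfolding D_def R1_def G_def
  proof (rule mult)
    fix i assume "i < n"
    with a b have "0 \<le> a i" "0 \<le> b i" by auto
    then show "sqrt (a i / b i) * inverse (a i) = inverse (sqrt (a i * b i))"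
      using real_sqrt_mult_self[of "a i"]
      by (cases "a i = 0") (simp_all add: real_sqrt_divide real_sqrt_mult divide_simps)
  qed
  have RD: "R2 * D' = G" unfolding D'_def R2_def G_def
  proof (rule mult)
    fix i assume "i < n"
    with a b have "0 \<le> a i" "0 \<le> b i" by auto
    then show "inverse (b i) * sqrt (b i / a i) = inverse (sqrt (a i * b i))"
      using real_sqrt_mult_self[of "b i"]
      by (cases "b i = 0") (simp_all add: real_sqrt_divide real_sqrt_mult divide_simps)
  qed
  have DD: "D * D' = Q" "D' * D = Q" unfolding D_def D'_def Q_def
    by (rule mult; use a b in \<open>simp add: real_sqrt_divide\<close>)+
  have QG: "Q * G = G" unfolding Q_def G_def by (rule mult) simp
  have GT: "G * T = Q" unfolding G_def T_def Q_def by (rule mult) simp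
  have TT: "T * T = P" unfolding T_def P by (rule mult) (use a b in simp)
  have QP: "Q * P = P" unfolding Q_def P by (rule mult) simp
  have QQ: "Q * Q = Q" unfolding Q_def by (rule mult) simp
  have adj: "mat_adjoint G = G" "mat_adjoint T = T" "mat_adjoint Q = Q"
    unfolding G_def T_def Q_def by (rule herm)+
  have MR: "M = R1 * E * R2" unfolding M R1_def R2_def ..
  have Mc: "M \<in> carrier_mat n n" unfolding MR using car E by simp
  define H where "H = G * E * G"
  have H: "H \<in> carrier_mat n n" unfolding H_def using car E by simp
  have adjE: "mat_adjoint E = E" using E by (simp add: hermitian_mat_def)
  have "hermitian_mat H" unfolding hermitian_mat_def H_def
    using car E by (simp add: mat_adjoint_mult[of _ n n _ n] adj adjE)
  \<comment> \<open>\<open>D\<close> and \<open>D'\<close> are inverse to each other on the range of \<open>P\<close>, onto which \<open>Q\<close> projects.\<close>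
  have HD: "H = D * M * D'"
  proof -
    have "D * M * D' = (D * R1) * E * (R2 * D')" unfolding MR using car E by simp
    then show ?thesis unfolding DR RD H_def by simp
  qed
  have QH: "Q * H = H"
  proof -
    have "Q * H = (Q * G) * (E * G)" unfolding H_def using car E by simp
    then show ?thesis unfolding QG H_def using car E by simp
  qed
  have normQ: "norm_sq (Q *\<^sub>v u) \<le> norm_sq u" if u: "u \<in> carrier_vec n" for u
  proof -
    let ?w = "mat_adjoint V *\<^sub>v u"
    have w: "?w \<in> carrier_vec n" using V u by (intro mult_mat_vec_carrier[of _ n n]) auto
    have "complex_of_real (norm_sq (Q *\<^sub>v u)) = (Q *\<^sub>v u) \<bullet>c u"
      using norm_sq_adjoint[OF car(7) u] by (simp add: adj QQ)
    also have "\<dots> = complex_of_real (\<Sum>i<n. (if a i * b i = 0 then 0 else 1) * (cmod (?w $ i))\<^sup>2)"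
      unfolding Q_def diag_conj_form[OF V u] by simp
    finally have "norm_sq (Q *\<^sub>v u) = (\<Sum>i<n. (if a i * b i = 0 then 0 else 1) * (cmod (?w $ i))\<^sup>2)"
      by (simp only: of_real_eq_iff)
    also have "\<dots> \<le> (\<Sum>i<n. (cmod (?w $ i))\<^sup>2)" by (rule sum_mono) auto
    also have "\<dots> = norm_sq ?w" using w by (simp add: norm_sq_def del: dim_mult_mat_vec index_mult_mat_vec)
    also have "\<dots> = norm_sq u"
      using V u by (intro norm_sq_unitary[of _ n] unitary_mat_adjoint) auto
    finally show ?thesis .
  qed
  have ev: "cmod c \<le> k" if "eigenvalue H c" for c
  proof (cases "c = 0")
    case False
    from that H obtain z where z: "z \<in> carrier_vec n" "z \<noteq> 0\<^sub>v n" and Hz: "H *\<^sub>v z = c \<cdot>\<^sub>v z"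
      by (auto simp: eigenvalue_def eigenvector_def)
    have "c \<cdot>\<^sub>v (Q *\<^sub>v z) = Q *\<^sub>v (H *\<^sub>v z)" unfolding Hz using car z by (simp add: mult_mat_vec[of _ n n])
    also have "\<dots> = (Q * H) *\<^sub>v z" using car H z by simp
    also have "\<dots> = c \<cdot>\<^sub>v z" unfolding QH Hz ..
    finally have "inverse c \<cdot>\<^sub>v (c \<cdot>\<^sub>v (Q *\<^sub>v z)) = inverse c \<cdot>\<^sub>v (c \<cdot>\<^sub>v z)" by simp
    then have Qz: "Q *\<^sub>v z = z" using False by (simp add: smult_smult_assoc)
    \<comment> \<open>\<open>w\<close> is an eigenvector of the compression \<open>Q M\<close> for the same eigenvalue \<open>c\<close>.\<close>
    define w where "w = D' *\<^sub>v z"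
    have w: "w \<in> carrier_vec n" unfolding w_def using car z by simp
    have "D *\<^sub>v w = (D * D') *\<^sub>v z" unfolding w_def using car z by simp
    then have Dw: "D *\<^sub>v w = z" unfolding DD Qz .
    have "w \<noteq> 0\<^sub>v n"
    proof
      assume "w = 0\<^sub>v n"
      then have "z = 0\<^sub>v n" using Dw car(3) by auto
      with z show False by simp
    qed
    then have pos: "0 < norm_sq w" using norm_sq_pos w by blast
    have "c \<cdot>\<^sub>v w = D' *\<^sub>v (H *\<^sub>v z)" unfolding Hz w_def using car z by (simp add: mult_mat_vec[of _ n n])
    also have "\<dots> = (D' * D) *\<^sub>v (M *\<^sub>v w)" unfolding HD w_def using car Mc z by simp
    finally have cw: "c \<cdot>\<^sub>v w = Q *\<^sub>v (M *\<^sub>v w)" unfolding DD .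
    have "(cmod c)\<^sup>2 * norm_sq w = norm_sq (Q *\<^sub>v (M *\<^sub>v w))" using cw norm_sq_smult by metis
    also have "\<dots> \<le> norm_sq (M *\<^sub>v w)" using Mc w by (intro normQ) simp
    also have "\<dots> \<le> k\<^sup>2 * norm_sq w" by (rule norm_M[OF w])
    finally have "(cmod c)\<^sup>2 \<le> k\<^sup>2" using pos by simp
    then show ?thesis using k by (simp add: power2_le_iff_abs_le)
  qed (use k in simp)
  have xc: "x \<in> carrier_vec n" unfolding x using car y by simp
  have Qx: "Q *\<^sub>v x = x"
  proof -
    have "Q *\<^sub>v x = (Q * P) *\<^sub>v y" unfolding x using car y by simp
    then show ?thesis unfolding QP x .
  qed
  define z where "z = T *\<^sub>v x"
  have z: "z \<in> carrier_vec n" unfolding z_def using car xc by simp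
  have Gz: "G *\<^sub>v z = x"
  proof -
    have "G *\<^sub>v z = (G * T) *\<^sub>v x" unfolding z_def using car xc by simp
    then show ?thesis unfolding GT Qx .
  qed
  have "(H *\<^sub>v z) \<bullet>c z = (G *\<^sub>v (E *\<^sub>v (G *\<^sub>v z))) \<bullet>c z" unfolding H_def using car E z by simp
  also have "\<dots> = (E *\<^sub>v x) \<bullet>c (mat_adjoint G *\<^sub>v z)"
    unfolding Gz using car E z xc by (intro adjoint_cscalar_prod[of _ n n]) auto
  finally have "(E *\<^sub>v x) \<bullet>c x = (H *\<^sub>v z) \<bullet>c z" unfolding adj Gz by simp
  moreover have "norm_sq z = Re ((P *\<^sub>v x) \<bullet>c x)"
  proof -
    have "complex_of_real (norm_sq z) = (P *\<^sub>v x) \<bullet>c x"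
      unfolding z_def norm_sq_adjoint[OF car(6) xc] adj TT ..
    then show ?thesis by (metis Re_complex_of_real)
  qed
  ultimately show ?thesis
    using hermitian_form_bound[OF H \<open>hermitian_mat H\<close> z ev] by simp
qed

section \<open>Dimension count\<close>

text \<open>Padding the coefficient rows with zero rows gives a singular square matrix.\<close>

lemma fewer_equations_than_unknowns:
  fixes rs :: "'a :: field vec list"
  assumes rs: "set rs \<subseteq> carrier_vec n" "length rs < n"
  obtains y where "y \<in> carrier_vec n" "y \<noteq> 0\<^sub>v n" "\<And>v. v \<in> set rs \<Longrightarrow> v \<bullet> y = 0"
proof -
  define c where "c i = (if i < length rs then rs ! i else 0\<^sub>v n)" for i
  have c: "c i \<in> carrier_vec n" for i using rs by (auto simp: c_def)
  define K where "K = mat\<^sub>r n n (\<lambda>i. if i = n - 1 then 0\<^sub>v n else c i)"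
  have K: "K \<in> carrier_mat n n" by (simp add: K_def)
  have "det K = 0" unfolding K_def using rs c by (intro det_row_0) auto
  then obtain y where y: "y \<in> carrier_vec n" "y \<noteq> 0\<^sub>v n" "K *\<^sub>v y = 0\<^sub>v n"
    using det_0_iff_vec_prod_zero_field[OF K] by blast
  have "v \<bullet> y = 0" if "v \<in> set rs" for v
  proof -
    from that obtain i where i: "i < length rs" "v = rs ! i" by (auto simp: in_set_conv_nth)
    then have "i < n" using rs by simp
    have "row K i = v"
      unfolding K_def using i rs c[of i] \<open>i < n\<close> by (subst row_mat_of_row_fun) (auto simp: c_def)
    moreover have "(K *\<^sub>v y) $ i = 0" using y \<open>i < n\<close> by simp
    ultimately show ?thesis using K \<open>i < n\<close> by simp
  qed
  with that y show thesis by blast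
qed

text \<open>Vanishing of \<open>y\<close> outside \<open>T\<close> and of \<open>Z y\<close> outside \<open>S\<close> amounts to
  \<open>(n - card T) + (n - card S) < n\<close> linear equations.\<close>

lemma supports_intersect:
  fixes Z :: "'a :: field mat"
  assumes Z: "Z \<in> carrier_mat n n" and T: "T \<subseteq> {..<n}" and S: "S \<subseteq> {..<n}"
    and card: "n < card T + card S"
  obtains y where "y \<in> carrier_vec n" "y \<noteq> 0\<^sub>v n" "\<And>i. i < n \<Longrightarrow> i \<notin> T \<Longrightarrow> y $ i = 0"
    "\<And>i. i < n \<Longrightarrow> i \<notin> S \<Longrightarrow> (Z *\<^sub>v y) $ i = 0"
proof -
  define ts where "ts = sorted_list_of_set ({..<n} - T)"
  define ss where "ss = sorted_list_of_set ({..<n} - S)"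
  have fin: "finite T" "finite S" using T S finite_subset by blast+
  have sets: "set ts = {..<n} - T" "set ss = {..<n} - S" by (simp_all add: ts_def ss_def)
  have "length ts = n - card T" "length ss = n - card S"
    using T S fin by (simp_all add: ts_def ss_def card_Diff_subset)
  moreover have "card T \<le> n" "card S \<le> n" using card_mono[OF _ T] card_mono[OF _ S] by auto
  ultimately have len: "length ts + length ss < n" using card by linarith
  let ?rs = "map (unit_vec n) ts @ map (row Z) ss"
  have "set ?rs \<subseteq> carrier_vec n" using Z by auto
  then obtain y where y: "y \<in> carrier_vec n" "y \<noteq> 0\<^sub>v n" "\<And>v. v \<in> set ?rs \<Longrightarrow> v \<bullet> y = 0"
    using fewer_equations_than_unknowns[of ?rs n] len by auto
  have "y $ i = 0" if "i < n" "i \<notin> T" for i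
    using y(3)[of "unit_vec n i"] y(1) that sets by simp
  moreover have "(Z *\<^sub>v y) $ i = 0" if "i < n" "i \<notin> S" for i
    using y(3)[of "row Z i"] Z that sets by simp
  ultimately show thesis using that y by blast
qed

lemma common_vector_of_supports:
  assumes U: "U \<in> carrier_mat n n" "unitary_mat U" and W: "W \<in> carrier_mat n n" "unitary_mat W"
    and T: "T \<subseteq> {..<n}" and S: "S \<subseteq> {..<n}" and card: "n < card T + card S"
  obtains y w where "y \<in> carrier_vec n" "\<And>i. i < n \<Longrightarrow> i \<notin> T \<Longrightarrow> y $ i = 0"
    "w \<in> carrier_vec n" "\<And>i. i < n \<Longrightarrow> i \<notin> S \<Longrightarrow> w $ i = 0"
    "U *\<^sub>v y = W *\<^sub>v w" "0 < norm_sq y" "norm_sq w = norm_sq y"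
proof -
  have Z: "mat_adjoint W * U \<in> carrier_mat n n" using U W by (intro mult_carrier_mat[of _ n n]) auto
  obtain y where y: "y \<in> carrier_vec n" "y \<noteq> 0\<^sub>v n" "\<And>i. i < n \<Longrightarrow> i \<notin> T \<Longrightarrow> y $ i = 0"
    "\<And>i. i < n \<Longrightarrow> i \<notin> S \<Longrightarrow> ((mat_adjoint W * U) *\<^sub>v y) $ i = 0"
    using supports_intersect[OF Z T S card] by blast
  define w where "w = (mat_adjoint W * U) *\<^sub>v y"
  have w: "w \<in> carrier_vec n" unfolding w_def using Z y by simp
  have Uy: "U *\<^sub>v y \<in> carrier_vec n" using U y by simp
  have "w = mat_adjoint W *\<^sub>v (U *\<^sub>v y)"
    unfolding w_def using U W y by (simp add: assoc_mult_mat_vec[of _ n n _ n])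
  then have Ww: "U *\<^sub>v y = W *\<^sub>v w" using unitary_mult_cancel[OF W Uy] by simp
  have "norm_sq w = norm_sq y"
    using norm_sq_unitary[OF W(2,1) w] norm_sq_unitary[OF U(2,1) y(1)] Ww by simp
  with that y w Ww norm_sq_pos[OF y(1,2)] show thesis unfolding w_def by blast
qed

section \<open>Comparing eigenvalues through the quadratic form\<close>

text \<open>This is the step of the min-max principle in which a test space meets an eigenspace: the vectors
  supported on \<open>T\<close> in the basis \<open>U\<close> and those supported on \<open>S\<close> in the basis \<open>W\<close> share a nonzero vector,
  on which the quadratic form is at least \<open>\<beta>\<close> and at most \<open>\<alpha>\<close> times the squared norm.\<close>

lemma eigenvalue_le_of_form_le:
  fixes m f :: "nat \<Rightarrow> real"
  assumes U: "U \<in> carrier_mat n n" "unitary_mat U" and W: "W \<in> carrier_mat n n" "unitary_mat W"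
    and T: "T \<subseteq> {..<n}" and S: "S \<subseteq> {..<n}" and card: "n < card T + card S"
    and form: "\<And>y. y \<in> carrier_vec n \<Longrightarrow> (\<And>j. j < n \<Longrightarrow> j \<notin> T \<Longrightarrow> y $ j = 0) \<Longrightarrow>
      Re ((diag_conj W (\<lambda>j. complex_of_real (m j)) *\<^sub>v (U *\<^sub>v y)) \<bullet>c (U *\<^sub>v y))
        \<le> (\<Sum>j<n. f j * (cmod (y $ j))\<^sup>2)"
    and f: "\<And>j. j \<in> T \<Longrightarrow> f j \<le> \<alpha>" and m: "\<And>j. j \<in> S \<Longrightarrow> \<beta> \<le> m j"
  shows "\<beta> \<le> \<alpha>"
proof -
  obtain y w where y: "y \<in> carrier_vec n" "\<And>j. j < n \<Longrightarrow> j \<notin> T \<Longrightarrow> y $ j = 0"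
    and w: "w \<in> carrier_vec n" "\<And>j. j < n \<Longrightarrow> j \<notin> S \<Longrightarrow> w $ j = 0"
    and yw: "U *\<^sub>v y = W *\<^sub>v w" "0 < norm_sq y" "norm_sq w = norm_sq y"
    using common_vector_of_supports[OF U W T S card] by blast
  have norm_sum: "c * norm_sq v = (\<Sum>j<n. c * (cmod (v $ j))\<^sup>2)" if "v \<in> carrier_vec n" for c v
    using that by (simp add: norm_sq_def sum_distrib_left)
  have "\<beta> * norm_sq y = (\<Sum>j<n. \<beta> * (cmod (w $ j))\<^sup>2)" using norm_sum[OF w(1)] yw(3) by simp
  also have "\<dots> \<le> (\<Sum>j<n. m j * (cmod (w $ j))\<^sup>2)"
  proof (rule sum_mono)
    fix j assume "j \<in> {..<n}"
    then show "\<beta> * (cmod (w $ j))\<^sup>2 \<le> m j * (cmod (w $ j))\<^sup>2"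
      using m[of j] w(2)[of j] by (cases "j \<in> S") (auto intro: mult_right_mono)
  qed
  also have "\<dots> = Re ((diag_conj W (\<lambda>j. complex_of_real (m j)) *\<^sub>v (U *\<^sub>v y)) \<bullet>c (U *\<^sub>v y))"
    unfolding yw(1) diag_conj_form_basis[OF W w(1)] by (simp flip: of_real_mult of_real_power)
  also have "\<dots> \<le> (\<Sum>j<n. f j * (cmod (y $ j))\<^sup>2)" using y by (rule form)
  also have "\<dots> \<le> (\<Sum>j<n. \<alpha> * (cmod (y $ j))\<^sup>2)"
  proof (rule sum_mono)
    fix j assume "j \<in> {..<n}"
    then show "f j * (cmod (y $ j))\<^sup>2 \<le> \<alpha> * (cmod (y $ j))\<^sup>2"
      using f[of j] y(2)[of j] by (cases "j \<in> T") (auto intro: mult_right_mono)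
  qed
  also have "\<dots> = \<alpha> * norm_sq y" using norm_sum[OF y(1)] by simp
  finally show ?thesis using yw(2) by simp
qed

lemma eigenvalue_ge_of_form_ge:
  fixes m f :: "nat \<Rightarrow> real"
  assumes U: "U \<in> carrier_mat n n" "unitary_mat U" and W: "W \<in> carrier_mat n n" "unitary_mat W"
    and TS: "T \<subseteq> {..<n}" "S \<subseteq> {..<n}" "n < card T + card S"
    and form: "\<And>y. y \<in> carrier_vec n \<Longrightarrow> (\<And>j. j < n \<Longrightarrow> j \<notin> T \<Longrightarrow> y $ j = 0) \<Longrightarrow>
      (\<Sum>j<n. f j * (cmod (y $ j))\<^sup>2)
        \<le> Re ((diag_conj W (\<lambda>j. complex_of_real (m j)) *\<^sub>v (U *\<^sub>v y)) \<bullet>c (U *\<^sub>v y))"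
    and f: "\<And>j. j \<in> T \<Longrightarrow> \<alpha> \<le> f j" and m: "\<And>j. j \<in> S \<Longrightarrow> m j \<le> \<beta>"
  shows "\<alpha> \<le> \<beta>"
proof -
  have neg: "Re ((diag_conj W (\<lambda>j. complex_of_real (- m j)) *\<^sub>v x) \<bullet>c x)
      = - Re ((diag_conj W (\<lambda>j. complex_of_real (m j)) *\<^sub>v x) \<bullet>c x)" if "x \<in> carrier_vec n" for x
    unfolding diag_conj_form[OF W that] by (simp add: sum_negf)
  have "- \<beta> \<le> - \<alpha>"
  proof (rule eigenvalue_le_of_form_le[OF U W TS])
    fix y :: "complex vec"
    assume y: "y \<in> carrier_vec n" "\<And>j. j < n \<Longrightarrow> j \<notin> T \<Longrightarrow> y $ j = 0"
    have "U *\<^sub>v y \<in> carrier_vec n" using U y by simp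
    with form[OF y] show "Re ((diag_conj W (\<lambda>j. complex_of_real (- m j)) *\<^sub>v (U *\<^sub>v y)) \<bullet>c (U *\<^sub>v y))
        \<le> (\<Sum>j<n. (- f j) * (cmod (y $ j))\<^sup>2)"
      unfolding neg[OF \<open>U *\<^sub>v y \<in> carrier_vec n\<close>] by (simp add: sum_negf)
  qed (use f m in auto)
  then show ?thesis by simp
qed

text \<open>The shift by \<open>k \<bar>t\<bar>\<close> is \<open>k\<close>-Lipschitz in \<open>t\<close>, so \<open>k \<le> 1\<close> keeps it from reversing the order of the
  eigenvalues of \<open>A\<close>.\<close>

lemma relative_shift_mono:
  fixes k s t :: real
  assumes "0 \<le> k" "k \<le> 1" "s \<le> t"
  shows "s + k * \<bar>s\<bar> \<le> t + k * \<bar>t\<bar>" "s - k * \<bar>s\<bar> \<le> t - k * \<bar>t\<bar>"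
proof -
  have "\<bar>k * \<bar>t\<bar> - k * \<bar>s\<bar>\<bar> = k * \<bar>\<bar>t\<bar> - \<bar>s\<bar>\<bar>"
    using assms(1) by (simp add: abs_mult flip: right_diff_distrib)
  also have "\<dots> \<le> 1 * (t - s)" using assms by (intro mult_mono) auto
  finally show "s + k * \<bar>s\<bar> \<le> t + k * \<bar>t\<bar>" "s - k * \<bar>s\<bar> \<le> t - k * \<bar>t\<bar>" by (auto simp: abs_le_iff)
qed

section \<open>The perturbation theorem\<close>

text \<open>The unitary factors drop out of the norm, so that \<open>k\<close> is the norm of \<open>P\<^sub>1\<^sup>+ E P\<^sub>2\<^sup>+\<close>, and the relative
  form bound applies in a common eigenbasis of \<open>P\<^sub>1\<close> and \<open>P\<^sub>2\<close>.\<close>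

lemma polar_factorisations_form_bound:
  assumes n: "0 < n" and E: "E \<in> carrier_mat n n" "hermitian_mat E"
    and A1: "A1 \<in> carrier_mat n n" "left_polar_factorisation A1 P1 S1"
    and A2: "A2 \<in> carrier_mat n n" "right_polar_factorisation A2 S2 P2"
    and comm: "P1 * P2 = P2 * P1"
    and k: "k = mat_norm2 (pseudo_inverse A1 * E * pseudo_inverse A2)"
  shows "0 \<le> k"
    and "y \<in> carrier_vec n \<Longrightarrow> x = (P1 * P2) *\<^sub>v y \<Longrightarrow>
      cmod ((E *\<^sub>v x) \<bullet>c x) \<le> k * Re (((P1 * P2) *\<^sub>v x) \<bullet>c x)"
proof -
  let ?dc = "\<lambda>V f. diag_conj V (\<lambda>i. complex_of_real (f i))"
  have S1: "S1 \<in> carrier_mat n n" "unitary_mat S1" and A1P: "A1 = P1 * S1"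
    and P1: "P1 = psd_sqrt (A1 * mat_adjoint A1)"
    using A1(2) unfolding left_polar_factorisation_def carrier_matD[OF A1(1)] by blast+
  have S2: "S2 \<in> carrier_mat n n" "unitary_mat S2" and A2P: "A2 = S2 * P2"
    and P2: "P2 = psd_sqrt (mat_adjoint A2 * A2)"
    using A2(2) unfolding right_polar_factorisation_def carrier_matD[OF A2(1)] by blast+
  have psd1: "P1 \<in> carrier_mat n n" "psd_mat P1"
    using psd_sqrt_props[of "A1 * mat_adjoint A1" n] psd_adjoint_mult[of "mat_adjoint A1" n] A1(1)
    unfolding P1 by (simp_all add: mult_carrier_mat[of _ n n _ n])
  have psd2: "P2 \<in> carrier_mat n n" "psd_mat P2"
    using psd_sqrt_props[of "mat_adjoint A2 * A2" n] psd_adjoint_mult[of A2 n] A2(1)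
    unfolding P2 by (simp_all add: mult_carrier_mat[of _ n n _ n])
  obtain V a b where V: "V \<in> carrier_mat n n" "unitary_mat V"
    and P1V: "P1 = ?dc V a" and P2V: "P2 = ?dc V b"
    and a: "\<And>j. j < n \<Longrightarrow> 0 \<le> a j" and b: "\<And>j. j < n \<Longrightarrow> 0 \<le> b j"
    by (rule commuting_psd_eigenbasis[OF psd1 psd2 comm]) blast
  have PV: "P1 * P2 = ?dc V (\<lambda>j. a j * b j)"
    unfolding P1V P2V diag_conj_mult[OF V] by simp
  define M where "M = ?dc V (\<lambda>j. inverse (a j)) * E * ?dc V (\<lambda>j. inverse (b j))"
  have M: "M \<in> carrier_mat n n" unfolding M_def using V E by (simp add: mult_carrier_mat[of _ n n _ n])
  let ?C = "mat_adjoint S1 * M * mat_adjoint S2"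
  have C: "?C \<in> carrier_mat n n" using M S1 S2 by (simp add: mult_carrier_mat[of _ n n _ n])
  have "pseudo_inverse A1 * E * pseudo_inverse A2 = ?C"
    unfolding A1P A2P P1V P2V pseudo_inverse_diag_conj_unitary(1)[OF V S1]
      pseudo_inverse_diag_conj_unitary(2)[OF V S2] M_def
    using V S1 S2 E by (simp add: assoc_mult_mat[of _ n n _ n _ n] mult_carrier_mat[of _ n n _ n])
  then have kC: "k = mat_norm2 ?C" using k by simp
  then show k0: "0 \<le> k" using mat_norm2_bound(1)[OF C n] by simp
  have norm_M: "norm_sq (M *\<^sub>v x) \<le> k\<^sup>2 * norm_sq x" if x: "x \<in> carrier_vec n" for x
  proof -
    have Mx: "M *\<^sub>v x \<in> carrier_vec n" and Sx: "S2 *\<^sub>v x \<in> carrier_vec n" using M S2 x by auto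
    have "?C *\<^sub>v (S2 *\<^sub>v x) = mat_adjoint S1 *\<^sub>v (M *\<^sub>v x)"
      using S1 S2 M x unitary_mult_cancel(2)[OF S2 x]
      by (simp add: assoc_mult_mat_vec[of _ n n _ n] mult_carrier_mat[of _ n n _ n]
        mult_mat_vec_carrier[of _ n n])
    then have "norm_sq (M *\<^sub>v x) = norm_sq (?C *\<^sub>v (S2 *\<^sub>v x))"
      using norm_sq_unitary[OF unitary_mat_adjoint[OF S1(2)] mat_adjoint_carrier[OF S1(1)] Mx] by simp
    also have "\<dots> \<le> k\<^sup>2 * norm_sq (S2 *\<^sub>v x)" unfolding kC by (rule mat_norm2_bound(2)[OF C n Sx])
    finally show ?thesis unfolding norm_sq_unitary[OF S2(2,1) x] .
  qed
  show "cmod ((E *\<^sub>v x) \<bullet>c x) \<le> k * Re (((P1 * P2) *\<^sub>v x) \<bullet>c x)"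
    if "y \<in> carrier_vec n" "x = (P1 * P2) *\<^sub>v y"
  proof (rule relative_form_bound[where P = "P1 * P2" and M = M])
    show "norm_sq (M *\<^sub>v u) \<le> k\<^sup>2 * norm_sq u" if "u \<in> carrier_vec n" for u
      using that by (rule norm_M)
  qed (fact V a b E k0 M_def PV that)+
qed

theorem theorem2p4:
  fixes n r :: nat
    and A E A1 A2 P P1 P2 S1 S2 :: "complex mat"
    and lam mu :: "nat \<Rightarrow> real"
    and k :: real
  assumes A: "A \<in> carrier_mat n n" "hermitian_mat A"
    and r: "r = vec_space.rank n A"
    and P: "P = polar_factor A"
    and lam: "eigenvalue_listing A lam"
      "\<forall>i\<in>{1..r}. lam i \<noteq> 0" "antimono_on {1..r} lam" "\<forall>i\<in>{r+1..n}. lam i = 0"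
    and E: "E \<in> carrier_mat n n" "hermitian_mat E"
    and A1: "A1 \<in> carrier_mat n n" "left_polar_factorisation A1 P1 S1"
    and A2: "A2 \<in> carrier_mat n n" "right_polar_factorisation A2 S2 P2"
    and comm: "P = P1 * P2" "P1 * P2 = P2 * P1"
    and k: "k = mat_norm2 (pseudo_inverse A1 * E * pseudo_inverse A2)" "k \<le> 1"
    and mu: "eigenvalue_listing (A + E) mu" "antimono_on {1..n} mu"
  shows "\<forall>i\<in>{1..r}. mu (n - r + i) \<le> lam i + k * \<bar>lam i\<bar> \<and> mu i \<ge> lam i - k * \<bar>lam i\<bar>"
proof (cases "r = 0")
  case False
  let ?dc = "\<lambda>V f. diag_conj V (\<lambda>i. complex_of_real (f i))"
  have rn: "r \<le> n" unfolding r using vec_space.rank_le_nc[OF A(1)] .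
  with False have n: "0 < n" by simp
  obtain U where U: "U \<in> carrier_mat n n" "unitary_mat U" and AU: "A = ?dc U (\<lambda>j. lam (Suc j))"
    by (rule hermitian_eigenbasis[OF A lam(1)]) blast
  note form_E = polar_factorisations_form_bound[OF n E A1 A2 comm(2) k(1), folded comm(1)]
  have PU: "P = ?dc U (\<lambda>j. \<bar>lam (Suc j)\<bar>)" unfolding P AU by (rule polar_factor_diag_conj[OF U])
  have AE: "A + E \<in> carrier_mat n n" using A E by simp
  have "hermitian_mat (A + E)"
  proof -
    have adj: "mat_adjoint A = A" "mat_adjoint E = E" using A E by (auto simp: hermitian_mat_def)
    have "mat_adjoint (A + E) = mat_adjoint A + mat_adjoint E"
      using A(1) E(1) by (intro eq_matI) auto
    moreover have "square_mat (A + E)" using A(1) E(1) by simp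
    ultimately show ?thesis unfolding hermitian_mat_def adj by auto
  qed
  then obtain W where W: "W \<in> carrier_mat n n" "unitary_mat W"
    and AEW: "A + E = ?dc W (\<lambda>j. mu (Suc j))"
    by (rule hermitian_eigenbasis[OF AE _ mu(1)]) blast
  have form: "\<bar>Re (((A + E) *\<^sub>v (U *\<^sub>v y)) \<bullet>c (U *\<^sub>v y)) - (\<Sum>j<n. lam (Suc j) * (cmod (y $ j))\<^sup>2)\<bar>
      \<le> k * (\<Sum>j<n. \<bar>lam (Suc j)\<bar> * (cmod (y $ j))\<^sup>2)"
    if y: "y \<in> carrier_vec n" and supp: "\<And>j. j < n \<Longrightarrow> j \<notin> {..<r} \<Longrightarrow> y $ j = 0" for y
  proof -
    let ?x = "U *\<^sub>v y"
    have x: "?x \<in> carrier_vec n" using U y by simp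
    \<comment> \<open>The support of \<open>y\<close> puts \<open>U y\<close> into the range of \<open>P\<close>: the eigenvalues of \<open>P\<close> can be divided out.\<close>
    have "?x = P *\<^sub>v (U *\<^sub>v vec n (\<lambda>j. y $ j / complex_of_real \<bar>lam (Suc j)\<bar>))"
      unfolding PU diag_conj_mult_basis[OF U vec_carrier]
    proof (intro arg_cong[of _ _ "\<lambda>v. U *\<^sub>v v"] eq_vecI)
      fix j assume "j < dim_vec (vec n (\<lambda>k. complex_of_real \<bar>lam (Suc k)\<bar>
          * vec n (\<lambda>j. y $ j / complex_of_real \<bar>lam (Suc j)\<bar>) $ k))"
      then have j: "j < n" by simp
      show "y $ j = vec n (\<lambda>k. complex_of_real \<bar>lam (Suc k)\<bar>
          * vec n (\<lambda>j. y $ j / complex_of_real \<bar>lam (Suc j)\<bar>) $ k) $ j"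
      proof (cases "j < r")
        case True
        then have "lam (Suc j) \<noteq> 0" using lam(2) by simp
        then show ?thesis using j by simp
      next
        case False
        then show ?thesis using j supp[OF j] by simp
      qed
    qed (use y in simp)
    moreover have "U *\<^sub>v vec n (\<lambda>j. y $ j / complex_of_real \<bar>lam (Suc j)\<bar>) \<in> carrier_vec n"
      using U by (intro mult_mat_vec_carrier[of _ n n]) auto
    ultimately have "cmod ((E *\<^sub>v ?x) \<bullet>c ?x) \<le> k * Re ((P *\<^sub>v ?x) \<bullet>c ?x)"
      by (intro form_E(2))
    also have "Re ((P *\<^sub>v ?x) \<bullet>c ?x) = (\<Sum>j<n. \<bar>lam (Suc j)\<bar> * (cmod (y $ j))\<^sup>2)"
      unfolding PU diag_conj_form_basis[OF U y] by (simp flip: of_real_mult of_real_power)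
    finally have "\<bar>Re ((E *\<^sub>v ?x) \<bullet>c ?x)\<bar> \<le> k * (\<Sum>j<n. \<bar>lam (Suc j)\<bar> * (cmod (y $ j))\<^sup>2)"
      using abs_Re_le_cmod order_trans by blast
    moreover have "Re ((A *\<^sub>v ?x) \<bullet>c ?x) = (\<Sum>j<n. lam (Suc j) * (cmod (y $ j))\<^sup>2)"
      unfolding AU diag_conj_form_basis[OF U y] by (simp flip: of_real_mult of_real_power)
    moreover have "((A + E) *\<^sub>v ?x) \<bullet>c ?x = (A *\<^sub>v ?x) \<bullet>c ?x + (E *\<^sub>v ?x) \<bullet>c ?x"
      using A(1) E(1) x by (simp add: add_mult_distrib_mat_vec[of _ n n] add_scalar_prod_distrib[of _ n])
    ultimately show ?thesis by simp
  qed
  have form_le: "Re ((?dc W (\<lambda>j. mu (Suc j)) *\<^sub>v (U *\<^sub>v y)) \<bullet>c (U *\<^sub>v y))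
        \<le> (\<Sum>j<n. (lam (Suc j) + k * \<bar>lam (Suc j)\<bar>) * (cmod (y $ j))\<^sup>2)"
    and form_ge: "(\<Sum>j<n. (lam (Suc j) - k * \<bar>lam (Suc j)\<bar>) * (cmod (y $ j))\<^sup>2)
        \<le> Re ((?dc W (\<lambda>j. mu (Suc j)) *\<^sub>v (U *\<^sub>v y)) \<bullet>c (U *\<^sub>v y))"
    if "y \<in> carrier_vec n" "\<And>j. j < n \<Longrightarrow> j \<notin> T \<Longrightarrow> y $ j = 0" "T \<subseteq> {..<r}" for y T
  proof -
    have "y $ j = 0" if "j < n" "j \<notin> {..<r}" for j
      using that \<open>T \<subseteq> {..<r}\<close> by (intro \<open>\<And>j. j < n \<Longrightarrow> j \<notin> T \<Longrightarrow> y $ j = 0\<close>) auto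
    note bound = form[OF \<open>y \<in> carrier_vec n\<close> this, unfolded AEW abs_le_iff]
    have "(\<Sum>j<n. (lam (Suc j) + k * \<bar>lam (Suc j)\<bar>) * (cmod (y $ j))\<^sup>2)
        = (\<Sum>j<n. lam (Suc j) * (cmod (y $ j))\<^sup>2) + k * (\<Sum>j<n. \<bar>lam (Suc j)\<bar> * (cmod (y $ j))\<^sup>2)"
      by (simp add: distrib_right sum.distrib sum_distrib_left mult.assoc)
    with bound show "Re ((?dc W (\<lambda>j. mu (Suc j)) *\<^sub>v (U *\<^sub>v y)) \<bullet>c (U *\<^sub>v y))
        \<le> (\<Sum>j<n. (lam (Suc j) + k * \<bar>lam (Suc j)\<bar>) * (cmod (y $ j))\<^sup>2)" by linarith
    have "(\<Sum>j<n. (lam (Suc j) - k * \<bar>lam (Suc j)\<bar>) * (cmod (y $ j))\<^sup>2)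
        = (\<Sum>j<n. lam (Suc j) * (cmod (y $ j))\<^sup>2) - k * (\<Sum>j<n. \<bar>lam (Suc j)\<bar> * (cmod (y $ j))\<^sup>2)"
      by (simp add: left_diff_distrib sum_subtractf sum_distrib_left mult.assoc)
    with bound show "(\<Sum>j<n. (lam (Suc j) - k * \<bar>lam (Suc j)\<bar>) * (cmod (y $ j))\<^sup>2)
        \<le> Re ((?dc W (\<lambda>j. mu (Suc j)) *\<^sub>v (U *\<^sub>v y)) \<bullet>c (U *\<^sub>v y))" by linarith
  qed
  show ?thesis
  proof (intro ballI conjI)
    fix i assume i: "i \<in> {1..r}"
    then have ir: "1 \<le> i" "i \<le> r" by auto
    \<comment> \<open>The test spaces are spanned by the eigenvectors of \<open>A\<close> for the eigenvalues number \<open>i, \<dots>, r\<close>, and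
      then by those for the eigenvalues number \<open>1, \<dots>, i\<close>. Each meets an eigenspace of \<open>A + E\<close> because the
      dimensions add up to \<open>n + 1\<close>.\<close>
    show "mu (n - r + i) \<le> lam i + k * \<bar>lam i\<bar>"
    proof (rule eigenvalue_le_of_form_le[OF U W _ _ _ form_le[where T = "{i - 1..<r}"]])
      show "n < card {i - 1..<r} + card {..<n - r + i}" using ir rn by simp
      show "lam (Suc j) + k * \<bar>lam (Suc j)\<bar> \<le> lam i + k * \<bar>lam i\<bar>" if "j \<in> {i - 1..<r}" for j
        using ir that by (intro relative_shift_mono form_E(1) k(2) monotone_onD[OF lam(3)]) auto
      show "mu (n - r + i) \<le> mu (Suc j)" if "j \<in> {..<n - r + i}" for j
        using ir rn that by (intro monotone_onD[OF mu(2)]) auto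
    qed (use ir rn in auto)
    show "lam i - k * \<bar>lam i\<bar> \<le> mu i"
    proof (rule eigenvalue_ge_of_form_ge[OF U W _ _ _ form_ge[where T = "{..<i}"]])
      show "n < card {..<i} + card {i - 1..<n}" using ir rn by simp
      show "lam i - k * \<bar>lam i\<bar> \<le> lam (Suc j) - k * \<bar>lam (Suc j)\<bar>" if "j \<in> {..<i}" for j
        using ir that by (intro relative_shift_mono form_E(1) k(2) monotone_onD[OF lam(3)]) auto
      show "mu (Suc j) \<le> mu i" if "j \<in> {i - 1..<n}" for j
        using ir rn that by (intro monotone_onD[OF mu(2)]) auto
    qed (use ir rn in auto)
  qed
qed simp

end
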